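(* Let $E$ be a nuclear Fréchet space with the properties $\underline{DN}$ and $\Omega$ and let $\varepsilon$ be the associated exponent sequence of $E$. Then $\delta(E)=\delta(\Lambda_1(\varepsilon))$ if and only if $E$ has a prominent bounded set and $\Delta(E)=\Lambda_1(\varepsilon)$.
   Context: The topology of a nuclear Fréchet space $E$ is given by an increasing sequence of Hilbertian seminorms $(\|\cdot\|_k)_{k\in\mathbb N}$; put $U_k=\{x\in E:\|x\|_k\le 1\}$, so $U_1\supset U_2\supset\cdots$ is a base of neighborhoods of zero. Kolmogorov diameters: for absolutely convex $V,U\subseteq E$ with $V\subseteq CU$ for some $C>0$, $d_n(V,U)=\inf\{\delta(V,U,L): L\text{ a subspace of }E,\ \dim L\le n\}$, $n=0,1,\dots$, where $\delta(V,U,L)=\inf\{t>0: V\subseteq tU+L\}$. Diametral dimension: $\Delta(E)=\{(t_n)_{n\in\mathbb N}:\forall p\ \exists q>p\ \lim_{n\to\infty}t_n d_n(U_q,U_p)=0\}$. Approximate diametral dimension: $\delta(E)=\bigcup_{U}\bigcup_{B}\{(t_n)_{n\in\mathbb N}:\lim_{n\to\infty}t_n/d_n(B,U)=0\}$, with $U$ running over all neighborhoods of zero and $B$ over all bounded subsets of $E$; equivalently $\delta(E)=\{(t_n)_{n\in\mathbb N}:\exists p\ \forall q>p\ \lim_{n\to\infty}t_n/d_n(U_q,U_p)=0\}$. Equalities and inclusions of $\Delta$'s and $\delta$'s are as sets of sequences. Prominent bounded set: an absolutely convex bounded set $B\subseteq E$ is prominent if for every sequence $(x_n)$, $\lim_{n\to\infty}x_nd_n(B,U_p)=0$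 for every $p$ implies $(x_n)\in\Delta(E)$. $\underline{DN}$: there is $p\in\mathbb N$ such that for each $k>p$ there exist $n>k$, $0<\tau<1$, $C>0$ with $\|x\|_k\le C\|x\|_p^{1-\tau}\|x\|_n^{\tau}$ for all $x\in E$. $\Omega$: for each $p\in\mathbb N$ there is $q>p$ such that for every $k>q$ there exist $0<\theta<1$, $C>0$ with $\|y\|_q^*\le C(\|y\|_p^* )^{1-\theta}(\|y\|_k^* )^{\theta}$ for all $y\in E'$, where $\|y\|_k^*=\sup\{|y(x)|:\|x\|_k\le1\}\in\mathbb R\cup\{+\infty\}$. Power series spaces: for an exponent sequence $\alpha=(\alpha_n)$ (non-negative, increasing, $\alpha_n\to+\infty$), $\Lambda_1(\alpha)=\{(x_n):\sup_n|x_n|e^{-\alpha_n/k}<\infty\ \forall k\in\mathbb N\}$ and $\Lambda_\infty(\alpha)=\{(x_n):\sup_n|x_n|e^{k\alpha_n}<\infty\ \forall k\in\mathbb N\}$, Fréchet spaces with these seminorms. All power series spaces are assumed nuclear; in particular $\Lambda_1(\varepsilon)$ is assumed nuclear for the associated exponent sequence $\varepsilon$. Known: $\Delta(\Lambda_1(\alpha))=\Lambda_1(\alpha)$; $\Delta(\Lambda_\infty(\alpha))=\Lambda_\infty(\alpha)'=\{(x_n):\exists R>0\ \sup_n|x_n|e^{-R\alpha_n}<\infty\}$; $\delta(\Lambda_1(\alpha))=\Lambda_1(\alpha)'=\{(x_n):\exists k\ \sup_n|x_n|e^{\alpha_n/k}<\infty\}$; $\delta(\Lambda_\infty(\alpha))=\Lambda_\infty(\alpha)$.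 Associated exponent sequence: for a nuclear Fréchet space $E$ with $\underline{DN}$ and $\Omega$ it is the exponent sequence $\varepsilon$ (known to exist, unique up to equivalence) with $\Delta(\Lambda_1(\varepsilon))\subseteq\Delta(E)\subseteq\Delta(\Lambda_\infty(\varepsilon))$ such that, moreover, $\Lambda_1(\alpha)\subseteq\Delta(E)$ implies $\Lambda_1(\alpha)\subseteq\Lambda_1(\varepsilon)$, and $\Delta(E)\subseteq\Lambda_\infty(\alpha)'$ implies $\Lambda_\infty(\varepsilon)'\subseteq\Lambda_\infty(\alpha)'$. It is also known that $\delta(\Lambda_\infty(\varepsilon))\subseteq\delta(E)\subseteq\delta(\Lambda_1(\varepsilon))$. *)

theory Defs
  imports "HOL-Analysis.Analysis" "HOL-Library.Function_Algebras"
begin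

(* Scalars.  Every field of class real_normed_field is isometrically isomorphic to the real or to
   the complex numbers (Gelfand-Mazur), so the type variable 'k covers exactly these two cases.

   Spaces.  The underlying vector space is a subspace carr of an ambient vector space given by the
   type 'e with scalar multiplication scl.  The sequence of seminorms smn is indexed from 0. *)

record ('k, 'e) seminormed_space =
  carr :: "'e set"
  scl :: "'k \<Rightarrow> 'e \<Rightarrow> 'e"
  smn :: "nat \<Rightarrow> 'e \<Rightarrow> real"

definition seminorm_on ::
    "('k::real_normed_field, 'e::ab_group_add, 'm) seminormed_space_scheme \<Rightarrow> ('e \<Rightarrow> real) \<Rightarrow> bool"
  where "seminorm_on E p \<longleftrightarrow>
    (\<forall>x\<in>carr E. 0 \<le> p x) \<and>
    (\<forall>a. \<forall>x\<in>carr E. p (scl E a x) = norm a * p x) \<and>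
    (\<forall>x\<in>carr E. \<forall>y\<in>carr E. p (x + y) \<le> p x + p y)"

definition frechet ::
    "('k::real_normed_field, 'e::ab_group_add, 'm) seminormed_space_scheme \<Rightarrow> bool"
  where "frechet E \<longleftrightarrow>
    vector_space (scl E) \<and> module.subspace (scl E) (carr E) \<and>
    (\<forall>k. seminorm_on E (smn E k)) \<and>
    (\<forall>k. \<forall>x\<in>carr E. smn E k x \<le> smn E (Suc k) x) \<and>
    (\<forall>x\<in>carr E. (\<forall>k. smn E k x = 0) \<longrightarrow> x = 0) \<and>
    (\<forall>X. range X \<subseteq> carr E \<and>
         (\<forall>k. \<forall>e>0. \<exists>N. \<forall>m\<ge>N. \<forall>n\<ge>N. smn E k (X m - X n) < e) \<longrightarrow>
         (\<exists>x\<in>carr E. \<forall>k. (\<lambda>n. smn E k (X n - x)) \<longlonglongrightarrow> 0))"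

(* Complex conjugation for a general scalar field: conj a = |a|^2 / a, and 0 / 0 = 0;
   see the two lemmas below. *)

definition scalar_conj :: "'k::real_normed_field \<Rightarrow> 'k"
  where "scalar_conj a = of_real ((norm a)\<^sup>2) / a"

lemma scalar_conj_real: "scalar_conj (a::real) = a"
  by (simp add: scalar_conj_def power2_eq_square)

lemma scalar_conj_complex: "scalar_conj (a::complex) = cnj a"
proof (cases "a = 0")
  case False
  then show ?thesis
    unfolding scalar_conj_def complex_norm_square by simp
qed (simp add: scalar_conj_def)

definition hilbertian_seminorm ::
    "('k::real_normed_field, 'e::ab_group_add, 'm) seminormed_space_scheme \<Rightarrow> ('e \<Rightarrow> real) \<Rightarrow> bool"
  where "hilbertian_seminorm E p \<longleftrightarrow>
    (\<exists>ip :: 'e \<Rightarrow> 'e \<Rightarrow> 'k.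
      (\<forall>x\<in>carr E. \<forall>y\<in>carr E. \<forall>z\<in>carr E. ip (x + y) z = ip x z + ip y z) \<and>
      (\<forall>a. \<forall>x\<in>carr E. \<forall>y\<in>carr E. ip (scl E a x) y = a * ip x y) \<and>
      (\<forall>x\<in>carr E. \<forall>y\<in>carr E. ip y x = scalar_conj (ip x y)) \<and>
      (\<forall>x\<in>carr E. ip x x = of_real ((p x)\<^sup>2)))"

definition linear_functional ::
    "('k::real_normed_field, 'e::ab_group_add, 'm) seminormed_space_scheme \<Rightarrow> ('e \<Rightarrow> 'k) \<Rightarrow> bool"
  where "linear_functional E y \<longleftrightarrow>
    (\<forall>x\<in>carr E. \<forall>z\<in>carr E. y (x + z) = y x + y z) \<and>
    (\<forall>a. \<forall>x\<in>carr E. y (scl E a x) = a * y x)"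

(* For every p there is q > p such that the canonical map between the local Banach spaces
   belonging to the q-th and the p-th seminorm is a nuclear operator.  The factors z j of the
   nuclear representation can be taken in E instead of the completion with respect to the p-th
   seminorm, because E has dense image there; a representation that is valid on E extends to the
   completion with respect to the q-th seminorm by continuity. *)

definition nuclear ::
    "('k::real_normed_field, 'e::ab_group_add, 'm) seminormed_space_scheme \<Rightarrow> bool"
  where "nuclear E \<longleftrightarrow>
    (\<forall>p. \<exists>q>p. \<exists>(c :: nat \<Rightarrow> 'k) (y :: nat \<Rightarrow> 'e \<Rightarrow> 'k) (z :: nat \<Rightarrow> 'e).
      summable (\<lambda>j. norm (c j)) \<and>
      (\<forall>j. linear_functional E (y j) \<and> (\<forall>x\<in>carr E. norm (y j x) \<le> smn E q x)) \<and>
      (\<forall>j. z j \<in> carr E \<and> smn E p (z j) \<le> 1) \<and>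
      (\<forall>x\<in>carr E. (\<lambda>N. smn E p (x - (\<Sum>j<N. scl E (c j * y j x) (z j)))) \<longlonglongrightarrow> 0))"

definition unit_ball_of :: "('k, 'e, 'm) seminormed_space_scheme \<Rightarrow> nat \<Rightarrow> 'e set"
  where "unit_ball_of E k = {x \<in> carr E. smn E k x \<le> 1}"

definition zero_nbhd :: "('k, 'e, 'm) seminormed_space_scheme \<Rightarrow> 'e set \<Rightarrow> bool"
  where "zero_nbhd E U \<longleftrightarrow>
    U \<subseteq> carr E \<and> (\<exists>k. \<exists>r>0. {x \<in> carr E. smn E k x \<le> r} \<subseteq> U)"

definition bounded_set :: "('k, 'e, 'm) seminormed_space_scheme \<Rightarrow> 'e set \<Rightarrow> bool"
  where "bounded_set E B \<longleftrightarrow> B \<subseteq> carr E \<and> (\<forall>k. \<exists>M. \<forall>x\<in>B. smn E k x \<le> M)"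

definition absolutely_convex ::
    "('k::real_normed_field, 'e::ab_group_add, 'm) seminormed_space_scheme \<Rightarrow> 'e set \<Rightarrow> bool"
  where "absolutely_convex E B \<longleftrightarrow>
    (\<forall>x\<in>B. \<forall>y\<in>B. \<forall>a b. norm a + norm b \<le> 1 \<longrightarrow> scl E a x + scl E b y \<in> B)"

(* Finite-dimensionality is explicit: vector_space.dim is 0 on infinite-dimensional spaces. *)

definition subspaces_dim_le ::
    "('k::real_normed_field, 'e::ab_group_add, 'm) seminormed_space_scheme \<Rightarrow> nat \<Rightarrow> 'e set set"
  where "subspaces_dim_le E n =
    {L. module.subspace (scl E) L \<and> L \<subseteq> carr E \<and>
        (\<exists>b. finite b \<and> card b \<le> n \<and> module.span (scl E) b = L)}"

(* The two infima are taken in the reals.  They are used only for sets V absorbed by U, where the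
   sets of admissible t are nonempty. *)

definition deviation ::
    "('k::real_normed_field, 'e::ab_group_add, 'm) seminormed_space_scheme \<Rightarrow>
      'e set \<Rightarrow> 'e set \<Rightarrow> 'e set \<Rightarrow> real"
  where "deviation E V U L =
    Inf {t. t > 0 \<and> V \<subseteq> {scl E (of_real t) u + l | u l. u \<in> U \<and> l \<in> L}}"

definition kolmogorov_diameter ::
    "('k::real_normed_field, 'e::ab_group_add, 'm) seminormed_space_scheme \<Rightarrow>
      nat \<Rightarrow> 'e set \<Rightarrow> 'e set \<Rightarrow> real"
  where "kolmogorov_diameter E n V U = (INF L\<in>subspaces_dim_le E n. deviation E V U L)"

definition diametral_dim ::
    "('k::real_normed_field, 'e::ab_group_add, 'm) seminormed_space_scheme \<Rightarrow> (nat \<Rightarrow> 'k) set"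
  where "diametral_dim E =
    {t. \<forall>p. \<exists>q>p.
       (\<lambda>n. t n * of_real (kolmogorov_diameter E n (unit_ball_of E q) (unit_ball_of E p)))
         \<longlonglongrightarrow> 0}"

(* The quotient is taken in the extended nonnegative reals: there a / 0 is infinite for a > 0
   and 0 / 0 = 0, whereas in a field a / 0 = 0 would put every sequence into the set (take
   B = {0}). *)

definition approx_diametral_dim ::
    "('k::real_normed_field, 'e::ab_group_add, 'm) seminormed_space_scheme \<Rightarrow> (nat \<Rightarrow> 'k) set"
  where "approx_diametral_dim E =
    (\<Union>U\<in>{U. zero_nbhd E U}. \<Union>B\<in>{B. bounded_set E B}.
      {t. (\<lambda>n. ennreal (norm (t n)) / ennreal (kolmogorov_diameter E n B U)) \<longlonglongrightarrow> 0})"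

definition prominent ::
    "('k::real_normed_field, 'e::ab_group_add, 'm) seminormed_space_scheme \<Rightarrow> 'e set \<Rightarrow> bool"
  where "prominent E B \<longleftrightarrow>
    absolutely_convex E B \<and> bounded_set E B \<and>
    (\<forall>x :: nat \<Rightarrow> 'k.
      (\<forall>p. (\<lambda>n. x n * of_real (kolmogorov_diameter E n B (unit_ball_of E p))) \<longlonglongrightarrow> 0) \<longrightarrow>
      x \<in> diametral_dim E)"

definition DN_underline :: "('k, 'e, 'm) seminormed_space_scheme \<Rightarrow> bool"
  where "DN_underline E \<longleftrightarrow>
    (\<exists>p. \<forall>k>p. \<exists>n>k. \<exists>\<tau> C. 0 < \<tau> \<and> \<tau> < 1 \<and> 0 < C \<and>
      (\<forall>x\<in>carr E. smn E k x \<le> C * smn E p x powr (1 - \<tau>) * smn E n x powr \<tau>))"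

definition topological_dual ::
    "('k::real_normed_field, 'e::ab_group_add, 'm) seminormed_space_scheme \<Rightarrow> ('e \<Rightarrow> 'k) set"
  where "topological_dual E =
    {y. linear_functional E y \<and> (\<exists>k C. \<forall>x\<in>carr E. norm (y x) \<le> C * smn E k x)}"

definition dual_norm ::
    "('k::real_normed_field, 'e, 'm) seminormed_space_scheme \<Rightarrow> nat \<Rightarrow> ('e \<Rightarrow> 'k) \<Rightarrow> ennreal"
  where "dual_norm E k y = (SUP x\<in>unit_ball_of E k. ennreal (norm (y x)))"

(* Real powers with positive exponent in the extended nonnegative reals. *)

definition ennreal_powr :: "ennreal \<Rightarrow> real \<Rightarrow> ennreal"
  where "ennreal_powr x a = (if x = \<infinity> then \<infinity> else ennreal (enn2real x powr a))"

definition Omega_property ::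
    "('k::real_normed_field, 'e::ab_group_add, 'm) seminormed_space_scheme \<Rightarrow> bool"
  where "Omega_property E \<longleftrightarrow>
    (\<forall>p. \<exists>q>p. \<forall>k>q. \<exists>\<theta> C. 0 < \<theta> \<and> \<theta> < 1 \<and> 0 < C \<and>
      (\<forall>y\<in>topological_dual E.
        dual_norm E q y \<le>
          ennreal C * ennreal_powr (dual_norm E p y) (1 - \<theta>) * ennreal_powr (dual_norm E k y) \<theta>))"

definition exponent_sequence :: "(nat \<Rightarrow> real) \<Rightarrow> bool"
  where "exponent_sequence \<alpha> \<longleftrightarrow>
    (\<forall>n. 0 \<le> \<alpha> n) \<and> mono \<alpha> \<and> filterlim \<alpha> at_top sequentially"

(* The seminorms of the power series spaces are listed for k = 1, 2, ...; hence the shift Suc k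
   (for k = 0 the quotient by k would be meaningless). *)

definition power_series_space_1 :: "(nat \<Rightarrow> real) \<Rightarrow> ('k::real_normed_field, nat \<Rightarrow> 'k) seminormed_space"
    (\<open>\<Lambda>\<^sub>1\<close>)
  where "\<Lambda>\<^sub>1 \<alpha> =
    \<lparr>carr = {x. \<forall>k\<ge>1. bdd_above (range (\<lambda>n. norm (x n) * exp (- \<alpha> n / real k)))},
     scl = (\<lambda>a x n. a * x n),
     smn = (\<lambda>k x. SUP n. norm (x n) * exp (- \<alpha> n / real (Suc k)))\<rparr>"

definition power_series_space_inf :: "(nat \<Rightarrow> real) \<Rightarrow> ('k::real_normed_field, nat \<Rightarrow> 'k) seminormed_space"
    (\<open>\<Lambda>\<^sub>\<infinity>\<close>)
  where "\<Lambda>\<^sub>\<infinity> \<alpha> =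
    \<lparr>carr = {x. \<forall>k\<ge>1. bdd_above (range (\<lambda>n. norm (x n) * exp (real k * \<alpha> n)))},
     scl = (\<lambda>a x n. a * x n),
     smn = (\<lambda>k x. SUP n. norm (x n) * exp (real (Suc k) * \<alpha> n))\<rparr>"

(* The dual of the infinite type power series space, as a sequence space. *)

definition power_series_dual_inf :: "(nat \<Rightarrow> real) \<Rightarrow> (nat \<Rightarrow> 'k::real_normed_field) set"
    (\<open>\<Lambda>'_dual\<^sub>\<infinity>\<close>)
  where "\<Lambda>_dual\<^sub>\<infinity> \<alpha> = {x. \<exists>R>0. bdd_above (range (\<lambda>n. norm (x n) * exp (- R * \<alpha> n)))}"

(* All power series spaces are understood to be nuclear; accordingly the exponent sequences
   competing in the two extremality conditions are those of nuclear power series spaces. *)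

definition associated_exponent_sequence ::
    "('k::real_normed_field, 'e::ab_group_add, 'm) seminormed_space_scheme \<Rightarrow> (nat \<Rightarrow> real) \<Rightarrow> bool"
  where "associated_exponent_sequence E \<epsilon> \<longleftrightarrow>
    exponent_sequence \<epsilon> \<and>
    diametral_dim (\<Lambda>\<^sub>1 \<epsilon> :: ('k, nat \<Rightarrow> 'k) seminormed_space) \<subseteq> diametral_dim E \<and>
    diametral_dim E \<subseteq> diametral_dim (\<Lambda>\<^sub>\<infinity> \<epsilon> :: ('k, nat \<Rightarrow> 'k) seminormed_space) \<and>
    (\<forall>\<alpha>. exponent_sequence \<alpha> \<longrightarrow> nuclear (\<Lambda>\<^sub>1 \<alpha> :: ('k, nat \<Rightarrow> 'k) seminormed_space) \<longrightarrow>
      carr (\<Lambda>\<^sub>1 \<alpha>) \<subseteq> diametral_dim E \<longrightarrow>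
      carr (\<Lambda>\<^sub>1 \<alpha> :: ('k, nat \<Rightarrow> 'k) seminormed_space) \<subseteq> carr (\<Lambda>\<^sub>1 \<epsilon>)) \<and>
    (\<forall>\<alpha>. exponent_sequence \<alpha> \<longrightarrow> nuclear (\<Lambda>\<^sub>\<infinity> \<alpha> :: ('k, nat \<Rightarrow> 'k) seminormed_space) \<longrightarrow>
      diametral_dim E \<subseteq> \<Lambda>_dual\<^sub>\<infinity> \<alpha> \<longrightarrow>
      (\<Lambda>_dual\<^sub>\<infinity> \<epsilon> :: (nat \<Rightarrow> 'k) set) \<subseteq> \<Lambda>_dual\<^sub>\<infinity> \<alpha>)"

end

theory Submission
  imports Defs
begin

text \<open>
  Everything rests on comparing, for bounded sets \<open>B\<close>, the sequences \<open>d\<^sub>n(B, U\<^sub>p)\<close> with the weights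
  \<open>exp (- \<epsilon>\<^sub>n / k)\<close> that define \<open>\<Lambda>\<^sub>1(\<epsilon>)\<close>.

  In \<open>\<Lambda>\<^sub>1(\<epsilon>)\<close> the diameters are explicit: those of two basic neighbourhoods are at most
  \<open>exp (- \<epsilon>\<^sub>n (1/p - 1/q))\<close>, and the unit cube is a bounded set with \<open>d\<^sub>n \<ge> exp (- \<epsilon>\<^sub>n / p)\<close>. Hence
  \<open>\<Lambda>\<^sub>1(\<epsilon>) \<subseteq> \<Delta>(\<Lambda>\<^sub>1(\<epsilon>)) \<subseteq> \<Delta>(E)\<close>, and \<open>\<delta>(\<Lambda>\<^sub>1(\<epsilon>))\<close> consists of the sequences that are eventually
  dominated by a multiple of a single weight. Every \<open>x \<in> \<Delta>(E)\<close> satisfies \<open>x\<^sub>n d\<^sub>n(B, U\<^sub>p) \<rightarrow> 0\<close> for all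
  \<open>p\<close>, because \<open>B\<close> lies in a multiple of each \<open>U\<^sub>q\<close>.

  The inclusion \<open>\<delta>(E) \<subseteq> \<delta>(\<Lambda>\<^sub>1(\<epsilon>))\<close> always holds: \<open>x\<^sub>n d\<^sub>n(B, U\<^sub>p) \<rightarrow> 0\<close> for all \<open>x \<in> \<Lambda>\<^sub>1(\<epsilon>)\<close>, and a
  gliding hump turns this into an estimate of \<open>d\<^sub>n(B, U\<^sub>p)\<close> by one of the weights
  (\<open>exponential_bound_if_null_on_power_series_1\<close>). So equality of the \<open>\<delta>\<close>'s means that, conversely,
  each weight is dominated by \<open>d\<^sub>n(B, U\<^sub>p)\<close> for some bounded set \<open>B\<close> and some \<open>p\<close>.

  Suppose this, with bounded sets \<open>B\<^sub>k\<close>. Then \<open>x \<in> \<Delta>(E)\<close> makes \<open>x\<^sub>n exp (- \<epsilon>\<^sub>n / k)\<close> bounded for every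
  \<open>k\<close>, whence \<open>\<Delta>(E) = \<Lambda>\<^sub>1(\<epsilon>)\<close>. A single absolutely convex bounded set absorbs all the \<open>B\<^sub>k\<close>
  (\<open>bounded_set_absorbing_sequence\<close>), and by the same estimate it is prominent.

  If, on the other hand, \<open>B\<close> is prominent and \<open>\<Delta>(E) = \<Lambda>\<^sub>1(\<epsilon>)\<close>, then the sequences with
  \<open>x\<^sub>n d\<^sub>n(B, U\<^sub>p) \<rightarrow> 0\<close> for all \<open>p\<close> lie in \<open>\<Lambda>\<^sub>1(\<epsilon>)\<close>, and a second gliding hump
  (\<open>weight_dominated_if_bounded_on_null_space\<close>) shows that each weight is dominated by some
  \<open>d\<^sub>n(B, U\<^sub>p)\<close>.
\<close>

section \<open>Kolmogorov diameters in graded spaces\<close>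

text \<open>
  The setting in which diameters of balls and bounded sets are compared, for \<open>E\<close> and for the power
  series space alike.
\<close>

locale graded_space = vector_space "scl E"
  for E :: "('k::real_normed_field, 'e::ab_group_add, 'm) seminormed_space_scheme" +
  assumes subspace_carr: "subspace (carr E)"
    and seminorm: "seminorm_on E (smn E k)"
    and smn_Suc: "x \<in> carr E \<Longrightarrow> smn E k x \<le> smn E (Suc k) x"
begin

lemma smn_mono: "x \<in> carr E \<Longrightarrow> p \<le> q \<Longrightarrow> smn E p x \<le> smn E q x"
  by (rule lift_Suc_mono_le[of "\<lambda>k. smn E k x"]) (auto intro: smn_Suc)

lemma smn_scale: "x \<in> carr E \<Longrightarrow> smn E k (scl E a x) = norm a * smn E k x"
  using seminorm[of k] by (auto simp: seminorm_on_def)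

lemma smn_triangle: "x \<in> carr E \<Longrightarrow> y \<in> carr E \<Longrightarrow> smn E k (x + y) \<le> smn E k x + smn E k y"
  using seminorm[of k] by (auto simp: seminorm_on_def)

text \<open>
  Absorption is what makes the infimum defining a deviation range over a nonempty set; over the
  empty set it would be an unspecified real number.
\<close>

definition absorbs :: "'e set \<Rightarrow> 'e set \<Rightarrow> bool"
  where "absorbs U V \<longleftrightarrow> (\<exists>c>0. \<forall>x\<in>V. \<exists>u\<in>U. x = scl E (of_real c) u)"

abbreviation admissible :: "'e set \<Rightarrow> 'e set \<Rightarrow> 'e set \<Rightarrow> real set"
  where "admissible V U L \<equiv> {t. t > 0 \<and> V \<subseteq> {scl E (of_real t) u + l | u l. u \<in> U \<and> l \<in> L}}"

lemma admissible_nonempty: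
  assumes "absorbs U V" "L \<in> subspaces_dim_le E n"
  shows "admissible V U L \<noteq> {}"
proof -
  obtain c where c: "c > 0" "\<forall>x\<in>V. \<exists>u\<in>U. x = scl E (of_real c) u"
    using assms(1) by (auto simp: absorbs_def)
  have "0 \<in> L"
    using assms(2) by (auto simp: subspaces_dim_le_def subspace_0)
  then have "c \<in> admissible V U L"
    using c by force
  then show ?thesis by blast
qed

lemma bdd_below_admissible: "bdd_below (admissible V U L)"
  by (rule bdd_belowI[of _ 0]) auto

lemma deviation_nonneg:
  assumes "absorbs U V" "L \<in> subspaces_dim_le E n"
  shows "0 \<le> deviation E V U L"
  unfolding deviation_def by (rule cInf_greatest[OF admissible_nonempty[OF assms]]) auto

lemma zero_in_subspaces_dim_le: "{0} \<in> subspaces_dim_le E n"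
  using subspace_carr
  by (auto simp: subspaces_dim_le_def subspace_0 intro!: exI[of _ "{}"])

lemma bdd_below_deviation:
  assumes "absorbs U V"
  shows "bdd_below ((\<lambda>L. deviation E V U L) ` subspaces_dim_le E n)"
  by (rule bdd_belowI[of _ 0]) (auto intro: deviation_nonneg[OF assms])

lemma kolmogorov_diameter_nonneg:
  assumes "absorbs U V"
  shows "0 \<le> kolmogorov_diameter E n V U"
  unfolding kolmogorov_diameter_def
  by (rule cINF_greatest) (use zero_in_subspaces_dim_le deviation_nonneg[OF assms] in auto)

lemma kolmogorov_diameter_le_admissible:
  assumes "absorbs U V" "L \<in> subspaces_dim_le E n" "t \<in> admissible V U L"
  shows "kolmogorov_diameter E n V U \<le> t"
proof -
  have "kolmogorov_diameter E n V U \<le> deviation E V U L"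
    unfolding kolmogorov_diameter_def
    by (rule cINF_lower[OF bdd_below_deviation[OF assms(1)] assms(2)])
  also have "\<dots> \<le> t"
    unfolding deviation_def by (rule cInf_lower[OF assms(3) bdd_below_admissible])
  finally show ?thesis .
qed

lemma kolmogorov_diameter_greatest:
  assumes "absorbs U V"
    and "\<And>L t. L \<in> subspaces_dim_le E n \<Longrightarrow> t \<in> admissible V U L \<Longrightarrow> m \<le> t"
  shows "m \<le> kolmogorov_diameter E n V U"
  unfolding kolmogorov_diameter_def
proof (rule cINF_greatest)
  fix L assume "L \<in> subspaces_dim_le E n"
  then show "m \<le> deviation E V U L"
    unfolding deviation_def
    by (intro cInf_greatest admissible_nonempty[OF assms(1)]) (use assms(2) in auto)
qed (use zero_in_subspaces_dim_le in auto)

text \<open>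
  A representation \<open>v = t u + l\<close> of a point of \<open>V'\<close>, multiplied by \<open>a\<close>, reads
  \<open>a v = (a t / b) (b u) + a l\<close>, so admissible factors transform by \<open>a / b\<close>. All comparisons
  of diameters below are instances.
\<close>

lemma kolmogorov_diameter_scale:
  assumes abs: "absorbs U' V'" and "a > 0" "b > 0"
    and V: "\<And>x. x \<in> V \<Longrightarrow> \<exists>v\<in>V'. x = scl E (of_real a) v"
    and U: "\<And>u. u \<in> U' \<Longrightarrow> scl E (of_real b) u \<in> U"
  shows "kolmogorov_diameter E n V U \<le> a / b * kolmogorov_diameter E n V' U'"
proof -
  have transfer: "a / b * t \<in> admissible V U L"
    if L: "L \<in> subspaces_dim_le E n" and t: "t \<in> admissible V' U' L" for L t
  proof -
    have "\<exists>u l. x = scl E (of_real (a / b * t)) u + l \<and> u \<in> U \<and> l \<in> L" if "x \<in> V" for x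
    proof -
      obtain v where v: "v \<in> V'" "x = scl E (of_real a) v"
        using V[OF \<open>x \<in> V\<close>] by blast
      obtain u l where ul: "v = scl E (of_real t) u + l" "u \<in> U'" "l \<in> L"
        using t v(1) by blast
      have "of_real (a / b * t) * of_real b = (of_real a * of_real t :: 'k)"
        using \<open>b > 0\<close> by (simp add: field_simps)
      then have "x = scl E (of_real (a / b * t)) (scl E (of_real b) u) + scl E (of_real a) l"
        by (simp only: v(2) ul(1) scale_right_distrib scale_scale)
      moreover have "scl E (of_real a) l \<in> L"
        using L ul(3) by (auto simp: subspaces_dim_le_def subspace_scale)
      ultimately show ?thesis
        using U[OF ul(2)] by blast
    qed
    then show ?thesis
      using t \<open>a > 0\<close> \<open>b > 0\<close> by auto
  qed
  have "absorbs U V"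
  proof -
    obtain c where c: "c > 0" "\<forall>x\<in>V'. \<exists>u\<in>U'. x = scl E (of_real c) u"
      using abs by (auto simp: absorbs_def)
    have "\<exists>u\<in>U. x = scl E (of_real (a * c / b)) u" if "x \<in> V" for x
    proof -
      obtain v where v: "v \<in> V'" "x = scl E (of_real a) v"
        using V[OF \<open>x \<in> V\<close>] by blast
      obtain u where u: "v = scl E (of_real c) u" "u \<in> U'"
        using c v(1) by blast
      have "of_real (a * c / b) * of_real b = (of_real a * of_real c :: 'k)"
        using \<open>b > 0\<close> by (simp add: field_simps)
      then have "x = scl E (of_real (a * c / b)) (scl E (of_real b) u)"
        by (simp only: v(2) u(1) scale_scale)
      with U[OF u(2)] show ?thesis by blast
    qed
    then show ?thesis
      unfolding absorbs_def using \<open>a > 0\<close> \<open>b > 0\<close> c(1)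
      by (intro exI[of _ "a * c / b"]) auto
  qed
  have "b / a * kolmogorov_diameter E n V U \<le> kolmogorov_diameter E n V' U'"
  proof (rule kolmogorov_diameter_greatest[OF abs])
    fix L t assume L: "L \<in> subspaces_dim_le E n" and t: "t \<in> admissible V' U' L"
    have "kolmogorov_diameter E n V U \<le> a / b * t"
      by (rule kolmogorov_diameter_le_admissible[OF \<open>absorbs U V\<close> L transfer[OF L t]])
    then show "b / a * kolmogorov_diameter E n V U \<le> t"
      using \<open>a > 0\<close> \<open>b > 0\<close> by (simp add: field_simps)
  qed
  then show ?thesis
    using \<open>a > 0\<close> \<open>b > 0\<close> by (simp add: field_simps)
qed

lemma bounded_set_in_multiple_of_ball:
  assumes "bounded_set E B"
  shows "\<exists>c>0. \<forall>x\<in>B. \<exists>u\<in>unit_ball_of E q. x = scl E (of_real c) u"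
proof -
  obtain M where M: "\<forall>x\<in>B. smn E q x \<le> M"
    using assms unfolding bounded_set_def by blast
  define c where "c = max M 1"
  have "\<exists>u\<in>unit_ball_of E q. x = scl E (of_real c) u" if "x \<in> B" for x
  proof (rule bexI[of _ "scl E (of_real (1 / c)) x"])
    have "x \<in> carr E" using assms that by (auto simp: bounded_set_def)
    moreover have "smn E q x \<le> c" "c > 0" using M that by (auto simp: c_def)
    ultimately show "scl E (of_real (1 / c)) x \<in> unit_ball_of E q"
      "x = scl E (of_real c) (scl E (of_real (1 / c)) x)"
      using subspace_carr
      by (auto simp: unit_ball_of_def smn_scale subspace_scale norm_divide field_simps
               simp flip: of_real_mult)
  qed
  moreover have "c > 0" by (simp add: c_def)
  ultimately show ?thesis by blast
qed

lemma absorbs_bounded_set: "bounded_set E B \<Longrightarrow> absorbs (unit_ball_of E p) B"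
  unfolding absorbs_def by (rule bounded_set_in_multiple_of_ball)

lemma absorbs_unit_ball: "p \<le> q \<Longrightarrow> absorbs (unit_ball_of E p) (unit_ball_of E q)"
  unfolding absorbs_def
  by (intro exI[of _ 1]) (auto simp: unit_ball_of_def intro: order_trans[OF smn_mono[of _ p q]])

lemma zero_nbhd_unit_ball: "zero_nbhd E (unit_ball_of E p)"
  unfolding zero_nbhd_def unit_ball_of_def by (intro conjI exI[of _ p] exI[of _ "1::real"]) auto

lemma diameter_zero_nbhd_le:
  assumes "bounded_set E B" "zero_nbhd E U"
  obtains p c where "c > 0"
    "\<And>n. kolmogorov_diameter E n B U \<le> c * kolmogorov_diameter E n B (unit_ball_of E p)"
proof -
  obtain p r where r: "r > 0" "{x \<in> carr E. smn E p x \<le> r} \<subseteq> U"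
    using assms(2) by (auto simp: zero_nbhd_def)
  have "scl E (of_real r) u \<in> U" if "u \<in> unit_ball_of E p" for u
    using that r subspace_carr mult_left_le[of "smn E p u" r]
    by (auto simp: unit_ball_of_def smn_scale subspace_scale)
  then have "kolmogorov_diameter E n B U \<le> 1 / r * kolmogorov_diameter E n B (unit_ball_of E p)"
    for n
    by (intro kolmogorov_diameter_scale absorbs_bounded_set assms r(1)) auto
  with r(1) show thesis by (intro that[of "1 / r" p]) auto
qed

lemma diameter_bounded_set_le:
  assumes "bounded_set E B" "p \<le> q"
  obtains c where "c > 0"
    "\<And>n. kolmogorov_diameter E n B (unit_ball_of E p)
         \<le> c * kolmogorov_diameter E n (unit_ball_of E q) (unit_ball_of E p)"
proof -
  obtain c where c: "c > 0" "\<forall>x\<in>B. \<exists>u\<in>unit_ball_of E q. x = scl E (of_real c) u"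
    using bounded_set_in_multiple_of_ball[OF assms(1)] by blast
  have "kolmogorov_diameter E n B (unit_ball_of E p)
      \<le> c / 1 * kolmogorov_diameter E n (unit_ball_of E q) (unit_ball_of E p)" for n
    by (intro kolmogorov_diameter_scale absorbs_unit_ball assms) (use c in auto)
  with c(1) show thesis by (intro that[of c]) auto
qed

lemma diameter_mono_ball:
  assumes "bounded_set E B" "p \<le> q"
  shows "kolmogorov_diameter E n B (unit_ball_of E p) \<le> kolmogorov_diameter E n B (unit_ball_of E q)"
proof -
  have "kolmogorov_diameter E n B (unit_ball_of E p)
      \<le> 1 / 1 * kolmogorov_diameter E n B (unit_ball_of E q)"
    by (intro kolmogorov_diameter_scale absorbs_bounded_set assms)
      (use smn_mono[OF _ \<open>p \<le> q\<close>] in \<open>auto simp: unit_ball_of_def intro: order_trans\<close>)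
  then show ?thesis by simp
qed

text \<open>
  A bounded set is contained in a multiple of every ball \<open>U\<^sub>q\<close>, so its diameters decay at least as
  fast as those of whichever \<open>U\<^sub>q\<close> the definition of the diametral dimension provides.
\<close>

lemma diametral_dim_bounded_set:
  assumes "x \<in> diametral_dim E" "bounded_set E B"
  shows "(\<lambda>n. x n * of_real (kolmogorov_diameter E n B (unit_ball_of E p))) \<longlonglongrightarrow> 0"
proof -
  obtain q where q: "q > p"
    "(\<lambda>n. x n * of_real (kolmogorov_diameter E n (unit_ball_of E q) (unit_ball_of E p))) \<longlonglongrightarrow> 0"
    using assms(1) by (auto simp: diametral_dim_def)
  obtain c where c: "c > 0"
    "\<And>n. kolmogorov_diameter E n B (unit_ball_of E p)
         \<le> c * kolmogorov_diameter E n (unit_ball_of E q) (unit_ball_of E p)"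
    using diameter_bounded_set_le[OF assms(2), of p q] q(1) by auto
  have nonneg: "0 \<le> kolmogorov_diameter E n B (unit_ball_of E p)" for n
    by (intro kolmogorov_diameter_nonneg absorbs_bounded_set assms(2))
  have "norm (x n * of_real (kolmogorov_diameter E n B (unit_ball_of E p)))
      \<le> norm (x n * of_real (kolmogorov_diameter E n (unit_ball_of E q) (unit_ball_of E p))) * c" for n
  proof -
    have "norm (x n) * kolmogorov_diameter E n B (unit_ball_of E p)
        \<le> norm (x n) * (c * kolmogorov_diameter E n (unit_ball_of E q) (unit_ball_of E p))"
      by (rule mult_left_mono[OF c(2)]) simp
    also have "\<dots> \<le> norm (x n) * (c * \<bar>kolmogorov_diameter E n (unit_ball_of E q) (unit_ball_of E p)\<bar>)"
      using c(1) by (intro mult_left_mono) auto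
    finally show ?thesis
      using nonneg[of n] by (simp add: norm_mult ac_simps)
  qed
  then show ?thesis
    by (intro Lim_null_comparison[OF _ tendsto_mult_left_zero[OF tendsto_norm_zero[OF q(2)], of c]])
      (auto intro: always_eventually)
qed

text \<open>
  The next two lemmas replace arbitrary neighbourhoods by balls and extended-real quotients by real
  inequalities. The conventions \<open>a / 0 = \<infinity>\<close> for \<open>a > 0\<close> and \<open>0 / 0 = 0\<close> are exactly those under
  which a bound on the quotient is the same as the corresponding inequality between products.
\<close>

lemma approx_diametral_dimD:
  assumes "t \<in> approx_diametral_dim E"
  obtains B p c where "bounded_set E B" "c > 0"
    "\<forall>\<^sub>F n in sequentially. norm (t n) \<le> c * kolmogorov_diameter E n B (unit_ball_of E p)"
proof -
  obtain U B where UB: "zero_nbhd E U" "bounded_set E B"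
    and lim: "(\<lambda>n. ennreal (norm (t n)) / ennreal (kolmogorov_diameter E n B U)) \<longlonglongrightarrow> 0"
    using assms by (auto simp: approx_diametral_dim_def)
  obtain p c where c: "c > 0"
    "\<And>n. kolmogorov_diameter E n B U \<le> c * kolmogorov_diameter E n B (unit_ball_of E p)"
    using diameter_zero_nbhd_le[OF UB(2,1)] by blast
  have nonneg: "0 \<le> kolmogorov_diameter E n B (unit_ball_of E p)" for n
    by (intro kolmogorov_diameter_nonneg absorbs_bounded_set UB)
  have "\<forall>\<^sub>F n in sequentially. ennreal (norm (t n)) / ennreal (kolmogorov_diameter E n B U) < 1"
    using order_tendstoD(2)[OF lim, of 1] by simp
  then have "\<forall>\<^sub>F n in sequentially. norm (t n) \<le> c * kolmogorov_diameter E n B (unit_ball_of E p)"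
  proof eventually_elim
    case (elim n)
    show ?case
    proof (cases "0 < kolmogorov_diameter E n B U")
      case True
      then have "norm (t n) < kolmogorov_diameter E n B U"
        using elim by (simp add: divide_ennreal)
      then show ?thesis using c(2)[of n] by linarith
    next
      case False
      then have "ennreal (kolmogorov_diameter E n B U) = 0"
        by (simp add: ennreal_neg)
      with elim have "norm (t n) = 0"
        by (cases "norm (t n) = 0") (auto simp: ennreal_divide_zero)
      then show ?thesis using nonneg[of n] c(1) by simp
    qed
  qed
  then show thesis by (rule that[OF UB(2) c(1)])
qed

lemma approx_diametral_dimI:
  assumes "bounded_set E B" and "c \<longlonglongrightarrow> 0"
    and "\<forall>\<^sub>F n in sequentially. norm (t n) \<le> c n * kolmogorov_diameter E n B (unit_ball_of E p)"
  shows "t \<in> approx_diametral_dim E"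
proof -
  have nonneg: "0 \<le> kolmogorov_diameter E n B (unit_ball_of E p)" for n
    by (intro kolmogorov_diameter_nonneg absorbs_bounded_set assms)
  have "\<forall>\<^sub>F n in sequentially.
      ennreal (norm (t n)) / ennreal (kolmogorov_diameter E n B (unit_ball_of E p)) \<le> ennreal (c n)"
    using assms(3)
  proof eventually_elim
    case (elim n)
    show ?case
    proof (cases "0 < kolmogorov_diameter E n B (unit_ball_of E p)")
      case True
      then show ?thesis
        using elim by (auto simp: divide_ennreal divide_le_eq intro!: ennreal_leI)
    next
      case False
      then have "kolmogorov_diameter E n B (unit_ball_of E p) = 0"
        using nonneg[of n] by linarith
      with elim show ?thesis by simp
    qed
  qed
  moreover have "(\<lambda>n. ennreal (c n)) \<longlonglongrightarrow> 0"
    using tendsto_ennrealI[OF assms(2)] by simp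
  ultimately have
    "(\<lambda>n. ennreal (norm (t n)) / ennreal (kolmogorov_diameter E n B (unit_ball_of E p))) \<longlonglongrightarrow> 0"
    by (rule tendsto_sandwich[OF always_eventually _ tendsto_const, rotated]) simp
  then show ?thesis
    unfolding approx_diametral_dim_def
    by (intro UN_I[of "unit_ball_of E p"] UN_I[of B]) (simp_all add: assms(1) zero_nbhd_unit_ball)
qed

text \<open>
  If \<open>M j k\<close> bounds the \<open>k\<close>-th seminorm on \<open>B j\<close>, the set is cut out by bounds \<open>R k\<close> with
  \<open>R k \<ge> M j k\<close> for all \<open>j \<le> k\<close>. A given \<open>B j\<close> then violates at most the bounds with \<open>k < j\<close>, and
  finitely many violations are repaired by one scaling.
\<close>

lemma bounded_set_absorbing_sequence:
  assumes bdd: "\<And>j::nat. bounded_set E (B j)"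
  obtains D where "absolutely_convex E D" "bounded_set E D" "\<And>j. absorbs D (B j)"
proof -
  have "\<exists>M. \<forall>x\<in>B j. smn E k x \<le> M" for j k
    using bdd[of j] unfolding bounded_set_def by blast
  then obtain M where M: "\<And>j k x. x \<in> B j \<Longrightarrow> smn E k x \<le> M j k"
    by metis
  define R where "R k = (\<Sum>j\<le>k. \<bar>M j k\<bar>) + 1" for k
  have R: "R k \<ge> 1" for k by (simp add: R_def sum_nonneg)
  define D where "D = {x \<in> carr E. \<forall>k. smn E k x \<le> R k}"
  have "absolutely_convex E D"
    unfolding absolutely_convex_def
  proof (intro ballI allI impI)
    fix x y and a b :: 'k
    assume xy: "x \<in> D" "y \<in> D" and ab: "norm a + norm b \<le> 1"
    have carr: "x \<in> carr E" "y \<in> carr E" using xy by (auto simp: D_def)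
    have ax: "scl E a x \<in> carr E" "scl E b y \<in> carr E"
      using carr subspace_carr by (auto intro: subspace_scale)
    have "smn E k (scl E a x + scl E b y) \<le> R k" for k
    proof -
      have "smn E k (scl E a x + scl E b y) \<le> norm a * smn E k x + norm b * smn E k y"
        using smn_triangle[OF ax] by (simp add: smn_scale carr)
      also have "\<dots> \<le> norm a * R k + norm b * R k"
        using xy by (intro add_mono mult_left_mono) (auto simp: D_def)
      also have "\<dots> = (norm a + norm b) * R k" by (simp add: distrib_right)
      also have "\<dots> \<le> R k"
        using ab R[of k] mult_right_mono[OF ab, of "R k"] by simp
      finally show ?thesis .
    qed
    then show "scl E a x + scl E b y \<in> D"
      using ax subspace_carr by (auto simp: D_def intro: subspace_add)
  qed
  moreover have "bounded_set E D"
    unfolding bounded_set_def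
  proof (intro conjI allI)
    show "\<exists>M. \<forall>x\<in>D. smn E k x \<le> M" for k
      by (rule exI[of _ "R k"]) (simp add: D_def)
  qed (auto simp: D_def)
  moreover have "absorbs D (B j)" for j
  proof -
    define c where "c = (\<Sum>k<j. \<bar>M j k\<bar>) + 1"
    have c: "c \<ge> 1" by (simp add: c_def sum_nonneg)
    have "scl E (of_real (1 / c)) x \<in> D" if x: "x \<in> B j" for x
    proof -
      have xE: "x \<in> carr E" using x bdd by (auto simp: bounded_set_def)
      have "smn E k x \<le> c * R k" for k
      proof (cases "k < j")
        case True
        then have "\<bar>M j k\<bar> \<le> (\<Sum>k<j. \<bar>M j k\<bar>)"
          by (intro member_le_sum) auto
        then have "smn E k x \<le> c" using M[OF x, of k] by (simp add: c_def)
        also have "c \<le> c * R k" using c R[of k] mult_left_mono[OF R[of k], of c] by simp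
        finally show ?thesis .
      next
        case False
        then have "\<bar>M j k\<bar> \<le> (\<Sum>j\<le>k. \<bar>M j k\<bar>)"
          by (intro member_le_sum[of j "{..k}" "\<lambda>j. \<bar>M j k\<bar>"]) auto
        then have "smn E k x \<le> R k" using M[OF x, of k] by (simp add: R_def)
        also have "R k \<le> c * R k" using R[of k] mult_right_mono[OF c, of "R k"] by simp
        finally show ?thesis .
      qed
      then show ?thesis
        using xE c subspace_carr
        by (auto simp: D_def smn_scale subspace_scale norm_divide field_simps)
    qed
    moreover have "x = scl E (of_real c) (scl E (of_real (1 / c)) x)" for x
      using c by (simp flip: of_real_mult)
    ultimately have "\<forall>x\<in>B j. \<exists>u\<in>D. x = scl E (of_real c) u"
      by blast
    then show ?thesis
      unfolding absorbs_def using c by (intro exI[of _ c]) simp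
  qed
  ultimately show thesis by (rule that)
qed

end

lemma graded_space_frechet: "frechet E \<Longrightarrow> graded_space E"
  unfolding frechet_def graded_space_def graded_space_axioms_def
  by (elim conjE) (intro conjI allI impI; simp)

section \<open>Power series spaces of finite type\<close>

lemma mem_carr_power_series_1:
  "x \<in> carr (\<Lambda>\<^sub>1 \<alpha>) \<longleftrightarrow> (\<forall>k. bdd_above (range (\<lambda>n. norm (x n) * exp (- \<alpha> n / real (Suc k)))))"
  unfolding power_series_space_1_def
  by (auto simp del: of_nat_Suc) (metis Suc_le_D)

text \<open>
  In this form the supremum in the seminorm never has to be handled again; membership in the space
  guarantees that it is a supremum of a bounded set.
\<close>

lemma smn_power_series_1_le_iff:
  assumes "x \<in> carr (\<Lambda>\<^sub>1 \<alpha>)"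
  shows "smn (\<Lambda>\<^sub>1 \<alpha>) k x \<le> M \<longleftrightarrow> (\<forall>n. norm (x n) * exp (- \<alpha> n / real (Suc k)) \<le> M)"
proof -
  have "bdd_above (range (\<lambda>n. norm (x n) * exp (- \<alpha> n / real (Suc k))))"
    using assms by (simp only: mem_carr_power_series_1)
  from cSUP_le_iff[OF _ this, of M] show ?thesis
    by (simp add: power_series_space_1_def)
qed

lemma graded_space_power_series_1:
  assumes "\<And>n. 0 \<le> \<alpha> n"
  shows "graded_space (\<Lambda>\<^sub>1 \<alpha> :: ('k::real_normed_field, nat \<Rightarrow> 'k) seminormed_space)"
proof -
  let ?E = "\<Lambda>\<^sub>1 \<alpha> :: ('k, nat \<Rightarrow> 'k) seminormed_space"
  have scl: "scl ?E = (\<lambda>a x n. a * x n)"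
    by (simp add: power_series_space_1_def)
  interpret vector_space "scl ?E"
    by unfold_locales (auto simp: scl fun_eq_iff algebra_simps)
  have le: "norm (x n) * exp (- \<alpha> n / real (Suc k)) \<le> smn ?E k x" if "x \<in> carr ?E" for x n k
    using smn_power_series_1_le_iff[OF that, of k "smn ?E k x"] by simp
  have add: "x + y \<in> carr ?E \<and> smn ?E k (x + y) \<le> smn ?E k x + smn ?E k y"
    if "x \<in> carr ?E" "y \<in> carr ?E" for x y k
  proof -
    have *: "norm ((x + y) n) * exp (- \<alpha> n / real (Suc k)) \<le> smn ?E k x + smn ?E k y" for n k
    proof -
      have "norm ((x + y) n) * exp (- \<alpha> n / real (Suc k))
          \<le> (norm (x n) + norm (y n)) * exp (- \<alpha> n / real (Suc k))"
        by (intro mult_right_mono) (auto simp: norm_triangle_ineq)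
      also have "\<dots> \<le> smn ?E k x + smn ?E k y"
        using le[OF that(1), of n k] le[OF that(2), of n k] by (simp add: distrib_right)
      finally show ?thesis .
    qed
    then have "x + y \<in> carr ?E"
      unfolding mem_carr_power_series_1 by (intro allI bdd_aboveI2) blast
    then show ?thesis using * by (simp only: smn_power_series_1_le_iff simp_thms)
  qed
  have scale: "scl ?E a x \<in> carr ?E \<and> smn ?E k (scl ?E a x) \<le> norm a * smn ?E k x"
    if "x \<in> carr ?E" for a x k
  proof -
    have *: "norm (scl ?E a x n) * exp (- \<alpha> n / real (Suc k)) \<le> norm a * smn ?E k x" for n k
      using mult_left_mono[OF le[OF that, of n k], of "norm a"]
      by (simp add: scl norm_mult mult.assoc)
    then have "scl ?E a x \<in> carr ?E"
      unfolding mem_carr_power_series_1 by (intro allI bdd_aboveI2) blast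
    then show ?thesis using * by (simp only: smn_power_series_1_le_iff simp_thms)
  qed
  have nonneg: "0 \<le> smn ?E k x" if "x \<in> carr ?E" for x k
    using le[OF that, of 0 k] by (rule order_trans[rotated]) simp
  have zero: "0 \<in> carr ?E" by (auto simp: mem_carr_power_series_1)
  have scale_eq: "smn ?E k (scl ?E a x) = norm a * smn ?E k x" if x: "x \<in> carr ?E" for a x k
  proof (cases "a = 0")
    case True
    then have "smn ?E k (scl ?E a x) \<le> 0" using scale[OF x, of a k] by simp
    moreover have "0 \<le> smn ?E k (scl ?E a x)" using scale[OF x] by (intro nonneg) blast
    ultimately show ?thesis using True by simp
  next
    case False
    have "smn ?E k (scl ?E (1 / a) (scl ?E a x)) \<le> norm (1 / a) * smn ?E k (scl ?E a x)"
      using scale scale[OF x] by blast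
    then have "norm a * smn ?E k x \<le> smn ?E k (scl ?E a x)"
      using False by (simp add: norm_divide field_simps)
    then show ?thesis using scale[OF x, of a k] by simp
  qed
  show ?thesis
  proof (unfold_locales)
    show "subspace (carr ?E)"
      using add scale zero by (auto simp: subspace_def)
    show "seminorm_on ?E (smn ?E k)" for k
      using add scale_eq nonneg by (auto simp: seminorm_on_def)
    show "smn ?E k x \<le> smn ?E (Suc k) x" if x: "x \<in> carr ?E" for x k
    proof -
      have "norm (x n) * exp (- \<alpha> n / real (Suc k)) \<le> smn ?E (Suc k) x" for n
      proof -
        have "\<alpha> n / real (Suc (Suc k)) \<le> \<alpha> n / real (Suc k)"
          using assms[of n] by (intro divide_left_mono) auto
        then have "norm (x n) * exp (- \<alpha> n / real (Suc k))
            \<le> norm (x n) * exp (- \<alpha> n / real (Suc (Suc k)))"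
          by (intro mult_left_mono) auto
        also have "\<dots> \<le> smn ?E (Suc k) x" by (rule le[OF x])
        finally show ?thesis .
      qed
      then show ?thesis by (simp only: smn_power_series_1_le_iff[OF x] simp_thms)
    qed
  qed
qed

text \<open>
  The first \<open>n\<close> unit vectors span an approximating subspace: cutting off the first \<open>n\<close> coordinates
  of a point of the \<open>q\<close>-th ball leaves coordinates \<open>m \<ge> n\<close>, on which passing to the \<open>p\<close>-th weight gains
  the factor \<open>exp (- \<alpha>\<^sub>m (1/(p+1) - 1/(q+1)))\<close>, largest at \<open>m = n\<close> because \<open>\<alpha>\<close> increases.
\<close>

lemma diameter_power_series_1_le:
  fixes \<alpha> :: "nat \<Rightarrow> real"
  assumes \<alpha>: "exponent_sequence \<alpha>" and "p \<le> q"
  defines "E \<equiv> \<Lambda>\<^sub>1 \<alpha> :: ('k::real_normed_field, nat \<Rightarrow> 'k) seminormed_space"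
  shows "kolmogorov_diameter E n (unit_ball_of E q) (unit_ball_of E p)
    \<le> exp (- \<alpha> n * (1 / real (Suc p) - 1 / real (Suc q)))"
proof -
  interpret graded_space E
    unfolding E_def by (rule graded_space_power_series_1) (use \<alpha> in \<open>auto simp: exponent_sequence_def\<close>)
  have scl: "scl E a x = (\<lambda>n. a * x n)" for a x
    by (simp add: power_series_space_1_def E_def)
  let ?t = "exp (- \<alpha> n * (1 / real (Suc p) - 1 / real (Suc q)))"
  define unit :: "nat \<Rightarrow> nat \<Rightarrow> 'k" where "unit i = (\<lambda>m. if m = i then 1 else 0)" for i
  define L where "L = span (unit ` {..<n})"
  have unit_carr: "unit i \<in> carr E" for i
    unfolding E_def mem_carr_power_series_1
    by (auto intro!: bdd_aboveI2[of _ _ "exp (- \<alpha> i / real (Suc _))"] simp: unit_def)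
  have "L \<subseteq> carr E"
    unfolding L_def by (intro span_minimal subspace_carr) (use unit_carr in blast)
  then have L_dim: "L \<in> subspaces_dim_le E n"
    unfolding subspaces_dim_le_def
    using card_image_le[of "{..<n}" unit] subspace_span[of "unit ` {..<n}"]
    by (intro CollectI conjI exI[of _ "unit ` {..<n}"]) (simp_all add: L_def)
  have "\<exists>u l. x = scl E (of_real ?t) u + l \<and> u \<in> unit_ball_of E p \<and> l \<in> L"
    if x: "x \<in> unit_ball_of E q" for x
  proof -
    define l where "l = (\<Sum>i<n. scl E (x i) (unit i))"
    have l: "l m = (if m < n then x m else 0)" for m
    proof -
      have "l m = (\<Sum>i<n. x i * unit i m)"
        unfolding l_def scl by (induction n) auto
      also have "\<dots> = (\<Sum>i<n. if i = m then x i else 0)"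
        by (intro sum.cong) (auto simp: unit_def)
      finally show ?thesis by simp
    qed
    have lL: "l \<in> L"
      unfolding l_def L_def by (intro span_sum span_scale span_base) auto
    define u where "u = (\<lambda>m. if m < n then 0 else x m / of_real ?t)"
    have u_eq: "u = scl E (of_real (1 / ?t)) (x - l)"
      by (auto simp: u_def scl l fun_eq_iff)
    have xE: "x \<in> carr E" and xq: "smn E q x \<le> 1"
      using x by (auto simp: unit_ball_of_def)
    have bound: "norm (u m) * exp (- \<alpha> m / real (Suc p)) \<le> 1" for m
    proof (cases "m < n")
      case False
      have "norm (x m) * exp (- \<alpha> m / real (Suc q)) \<le> 1"
        using xE xq unfolding E_def by (simp only: smn_power_series_1_le_iff)
      then have "norm (x m) * exp (- \<alpha> m / real (Suc q))
          * exp (- \<alpha> m * (1 / real (Suc p) - 1 / real (Suc q)))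
        \<le> exp (- \<alpha> m * (1 / real (Suc p) - 1 / real (Suc q)))"
        by (simp del: of_nat_Suc)
      also have "\<dots> \<le> ?t"
      proof -
        have "\<alpha> n \<le> \<alpha> m" using False \<alpha> by (auto simp: exponent_sequence_def mono_def)
        moreover have "0 \<le> 1 / real (Suc p) - 1 / real (Suc q)"
          using \<open>p \<le> q\<close> by (simp add: frac_le)
        ultimately show ?thesis by (simp add: mult_right_mono del: of_nat_Suc)
      qed
      finally have "norm (x m) * exp (- \<alpha> m / real (Suc p)) \<le> ?t"
        by (simp add: mult.assoc algebra_simps del: of_nat_Suc flip: exp_add)
      then show ?thesis using False
        by (simp add: u_def norm_divide divide_le_eq del: of_nat_Suc)
    qed (simp add: u_def)
    have "l \<in> carr E"
      using lL \<open>L \<subseteq> carr E\<close> by blast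
    then have "u \<in> carr E"
      unfolding u_eq using subspace_carr xE by (intro subspace_scale subspace_diff)
    moreover have "smn E p u \<le> 1"
      using bound \<open>u \<in> carr E\<close> unfolding E_def by (simp only: smn_power_series_1_le_iff simp_thms)
    moreover have "x = scl E (of_real ?t) u + l"
      by (auto simp: fun_eq_iff u_def l scl)
    ultimately show ?thesis using lL by (auto simp: unit_ball_of_def)
  qed
  then show ?thesis
    by (intro kolmogorov_diameter_le_admissible[OF absorbs_unit_ball[OF \<open>p \<le> q\<close>] L_dim]) auto
qed

text \<open>
  A homogeneous linear system with fewer equations than unknowns has a nonzero solution. One
  equation \<open>s\<close> is used to eliminate an unknown \<open>j\<close> with \<open>v s j \<noteq> 0\<close> from the others.
\<close>

lemma exists_nontrivial_annihilator:
  fixes v :: "'b \<Rightarrow> 'i \<Rightarrow> 'k::field"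
  assumes "finite S" "finite I" "card S < card I"
  shows "\<exists>a. (\<exists>i\<in>I. a i \<noteq> 0) \<and> (\<forall>s\<in>S. (\<Sum>i\<in>I. a i * v s i) = 0)"
  using assms
proof (induction S arbitrary: I v rule: finite_induct)
  case empty
  then have "I \<noteq> {}" by auto
  then show ?case by (intro exI[of _ "\<lambda>_. 1"]) auto
next
  case (insert s S)
  show ?case
  proof (cases "\<forall>i\<in>I. v s i = 0")
    case True
    then show ?thesis using insert.IH[of I v] insert by auto
  next
    case False
    then obtain j where j: "j \<in> I" "v s j \<noteq> 0" by blast
    define w where "w r i = v r i - v r j / v s j * v s i" for r i
    have "card S < card (I - {j})"
      using insert j by simp
    then obtain a where a: "\<exists>i\<in>I - {j}. a i \<noteq> 0" "\<forall>r\<in>S. (\<Sum>i\<in>I - {j}. a i * w r i) = 0"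
      using insert.IH[of "I - {j}" w] insert.prems by auto
    define A where "A = (\<Sum>i\<in>I - {j}. a i * v s i)"
    define b where "b = a(j := - A / v s j)"
    have split: "(\<Sum>i\<in>I. b i * v r i) = - A / v s j * v r j + (\<Sum>i\<in>I - {j}. a i * v r i)" for r
    proof -
      have "(\<Sum>i\<in>I - {j}. b i * v r i) = (\<Sum>i\<in>I - {j}. a i * v r i)"
        by (intro sum.cong) (auto simp: b_def)
      then show ?thesis
        using sum.remove[OF insert.prems(1) j(1), of "\<lambda>i. b i * v r i"] by (simp add: b_def)
    qed
    have "(\<Sum>i\<in>I. b i * v r i) = 0" if "r \<in> S" for r
    proof -
      have "0 = (\<Sum>i\<in>I - {j}. a i * w r i)" using a(2) that by simp
      also have "\<dots> = (\<Sum>i\<in>I - {j}. a i * v r i) - v r j / v s j * A"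
        unfolding w_def A_def by (simp add: right_diff_distrib sum_subtractf sum_distrib_left ac_simps)
      finally show ?thesis by (simp add: split field_simps)
    qed
    moreover have "(\<Sum>i\<in>I. b i * v s i) = 0"
      using j(2) by (simp add: split flip: A_def)
    moreover have "\<exists>i\<in>I. b i \<noteq> 0" using a(1) by (auto simp: b_def)
    ultimately show ?thesis by (intro exI[of _ b]) auto
  qed
qed

lemma bounded_set_cube:
  assumes "\<And>n. 0 \<le> \<alpha> n"
  shows "bounded_set (\<Lambda>\<^sub>1 \<alpha> :: ('k::real_normed_field, nat \<Rightarrow> 'k) seminormed_space) {x. \<forall>n. norm (x n) \<le> 1}"
proof -
  have le: "norm (x n) * exp (- \<alpha> n / real (Suc k)) \<le> 1" if "\<forall>n. norm (x n) \<le> 1"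
    for x :: "nat \<Rightarrow> 'k" and n k
    using that assms[of n] by (intro mult_le_one) (auto simp: divide_nonneg_nonneg)
  then have carr: "x \<in> carr (\<Lambda>\<^sub>1 \<alpha>)" if "\<forall>n. norm (x n) \<le> 1" for x :: "nat \<Rightarrow> 'k"
    unfolding mem_carr_power_series_1 using that by (intro allI bdd_aboveI2) blast
  show ?thesis
    unfolding bounded_set_def
    using carr le by (auto simp: smn_power_series_1_le_iff simp del: of_nat_Suc intro!: exI[of _ 1])
qed

text \<open>
  A subspace of dimension at most \<open>n\<close> is annihilated by a nonzero functional \<open>f\<close> in the first \<open>n + 1\<close>
  coordinates. On the cube \<open>f\<close> attains the sum \<open>S\<close> of the absolute values of its coefficients, at the
  point \<open>z\<close> below, whereas on the \<open>p\<close>-th ball it is at most \<open>S exp (\<alpha>\<^sub>n / (p+1))\<close>. Applying \<open>f\<close> to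
  \<open>z = t u + l\<close> therefore bounds \<open>t\<close> from below. Duality avoids any compactness argument, so the
  scalar field can stay arbitrary.
\<close>

lemma diameter_cube_ge:
  fixes \<alpha> :: "nat \<Rightarrow> real"
  assumes \<alpha>: "exponent_sequence \<alpha>"
  defines "E \<equiv> \<Lambda>\<^sub>1 \<alpha> :: ('k::real_normed_field, nat \<Rightarrow> 'k) seminormed_space"
  shows "exp (- \<alpha> n / real (Suc p))
    \<le> kolmogorov_diameter E n {x. \<forall>n. norm (x n) \<le> 1} (unit_ball_of E p)"
proof -
  have pos: "0 \<le> \<alpha> n" for n using \<alpha> by (auto simp: exponent_sequence_def)
  interpret graded_space E
    unfolding E_def by (rule graded_space_power_series_1[OF pos])
  have scl: "scl E a x = (\<lambda>n. a * x n)" for a x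
    by (simp add: power_series_space_1_def E_def)
  let ?Q = "{x :: nat \<Rightarrow> 'k. \<forall>n. norm (x n) \<le> 1}"
  show ?thesis
  proof (rule kolmogorov_diameter_greatest)
    show "absorbs (unit_ball_of E p) ?Q"
      unfolding E_def[symmetric]
      by (rule absorbs_bounded_set) (use bounded_set_cube[OF pos] in \<open>simp add: E_def\<close>)
  next
    fix L t assume L: "L \<in> subspaces_dim_le E n" and t: "t \<in> admissible ?Q (unit_ball_of E p) L"
    obtain b where b: "finite b" "card b \<le> n" "span b = L"
      using L by (auto simp: subspaces_dim_le_def)
    obtain a where a: "\<exists>i\<in>{..n}. a i \<noteq> 0" "\<forall>v\<in>b. (\<Sum>i\<le>n. a i * v i) = 0"
      using exists_nontrivial_annihilator[of b "{..n}" "\<lambda>v. v"] b by auto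
    define f where "f x = (\<Sum>i\<le>n. a i * x i)" for x
    have f_add: "f (x + y) = f x + f y" for x y
      by (simp add: f_def distrib_left sum.distrib)
    have f_scale: "f (scl E c x) = c * f x" for c x
      by (simp add: f_def scl sum_distrib_left ac_simps)
    have f_L: "f l = 0" if "l \<in> L" for l
    proof -
      have "subspace {x. f x = 0}"
        by (auto simp: subspace_def f_add f_scale) (simp add: f_def)
      then have "span b \<subseteq> {x. f x = 0}"
        using a(2) by (intro span_minimal) (auto simp: f_def)
      with that b(3) show ?thesis by blast
    qed
    define S where "S = (\<Sum>i\<le>n. norm (a i))"
    have "S > 0"
      using a(1) unfolding S_def by (auto intro!: sum_pos2)
    define z where "z i = (if i \<le> n \<and> a i \<noteq> 0 then of_real (norm (a i)) / a i else 0)" for i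
    have "z \<in> ?Q" by (auto simp: z_def norm_divide)
    then obtain u l where ul: "z = scl E (of_real t) u + l" "u \<in> unit_ball_of E p" "l \<in> L"
      using t by blast
    have "f z = of_real S"
      unfolding f_def S_def of_real_sum by (intro sum.cong) (auto simp: z_def)
    then have "S = norm (f z)" using \<open>S > 0\<close> by simp
    also have "f z = of_real t * f u"
      by (simp add: ul(1) f_add f_scale f_L[OF ul(3)])
    also have "norm (of_real t * f u) = t * norm (f u)" using t by (simp add: norm_mult)
    also have "\<dots> \<le> t * (S * exp (\<alpha> n / real (Suc p)))"
    proof (intro mult_left_mono)
      have "norm (f u) \<le> (\<Sum>i\<le>n. norm (a i) * norm (u i))"
        unfolding f_def by (rule order_trans[OF norm_sum]) (simp add: norm_mult)
      also have "\<dots> \<le> (\<Sum>i\<le>n. norm (a i) * exp (\<alpha> n / real (Suc p)))"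
      proof (intro sum_mono mult_left_mono)
        fix i assume "i \<in> {..n}"
        have "u \<in> carr E" "smn E p u \<le> 1" using ul(2) by (auto simp: unit_ball_of_def)
        then have "norm (u i) * exp (- \<alpha> i / real (Suc p)) \<le> 1"
          unfolding E_def by (simp only: smn_power_series_1_le_iff)
        then have "norm (u i) \<le> exp (\<alpha> i / real (Suc p))"
          by (simp add: exp_minus field_simps del: of_nat_Suc)
        also have "\<dots> \<le> exp (\<alpha> n / real (Suc p))"
          using \<alpha> \<open>i \<in> {..n}\<close> by (auto simp: exponent_sequence_def mono_def intro!: divide_right_mono)
        finally show "norm (u i) \<le> exp (\<alpha> n / real (Suc p))" .
      qed auto
      finally show "norm (f u) \<le> S * exp (\<alpha> n / real (Suc p))"
        by (simp add: S_def sum_distrib_right)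
    qed (use t in auto)
    finally have "1 \<le> t * exp (\<alpha> n / real (Suc p))"
      using \<open>S > 0\<close> by (simp add: field_simps del: of_nat_Suc)
    then show "exp (- \<alpha> n / real (Suc p)) \<le> t"
      by (simp add: exp_minus field_simps del: of_nat_Suc)
  qed
qed

lemma tendsto_exp_neg_exponent:
  assumes "exponent_sequence \<alpha>" "c > 0"
  shows "(\<lambda>n. exp (- \<alpha> n * c)) \<longlonglongrightarrow> 0"
proof -
  have "filterlim (\<lambda>n. \<alpha> n * c) at_top sequentially"
    using assms by (auto simp: exponent_sequence_def intro: filterlim_tendsto_pos_mult_at_top filterlim_at_top_mult_tendsto_pos[OF tendsto_const])
  then have "filterlim (\<lambda>n. - (\<alpha> n * c)) at_bot sequentially"
    by (simp add: filterlim_uminus_at_bot)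
  then show ?thesis
    by (simp add: filterlim_compose[OF exp_at_bot])
qed

lemma bdd_above_range_if_eventually_le:
  fixes f :: "nat \<Rightarrow> real"
  assumes "\<forall>\<^sub>F n in sequentially. f n \<le> c"
  shows "bdd_above (range f)"
proof -
  obtain N where N: "\<And>n. n \<ge> N \<Longrightarrow> f n \<le> c"
    using assms by (auto simp: eventually_sequentially)
  have "bdd_above (f ` {..<N} \<union> f ` {N..})"
    using N by (auto intro!: bdd_aboveI[of "f ` {N..}" c])
  moreover have "range f \<subseteq> f ` {..<N} \<union> f ` {N..}"
    unfolding image_Un[symmetric] by (rule image_mono) auto
  ultimately show ?thesis by (rule bdd_above_mono)
qed

lemma power_series_1_subset_diametral_dim:
  assumes \<alpha>: "exponent_sequence \<alpha>"
  shows "carr (\<Lambda>\<^sub>1 \<alpha>) \<subseteq> diametral_dim (\<Lambda>\<^sub>1 \<alpha> :: ('k::real_normed_field, nat \<Rightarrow> 'k) seminormed_space)"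
proof
  let ?E = "\<Lambda>\<^sub>1 \<alpha> :: ('k, nat \<Rightarrow> 'k) seminormed_space"
  fix x assume x: "x \<in> carr ?E"
  interpret graded_space ?E
    by (rule graded_space_power_series_1) (use \<alpha> in \<open>auto simp: exponent_sequence_def\<close>)
  show "x \<in> diametral_dim ?E"
    unfolding diametral_dim_def
  proof (intro CollectI allI)
    fix p :: nat
    \<comment> \<open>The weights have index shifted by one; \<open>1 / (q + 1)\<close> is spent twice, for \<open>x\<close> and for the
        diameter, and has to stay below half of \<open>1 / (p + 1)\<close>.\<close>
    define q where "q = 3 * p + 3"
    define c where "c = 1 / real (Suc p) - 1 / real (Suc q) - 1 / real (Suc q)"
    have "1 / real (Suc q) \<le> 1 / (3 * real (Suc p))"
      by (intro divide_left_mono) (auto simp: q_def)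
    also have "\<dots> = (1 / real (Suc p)) / 3" by simp
    finally have "1 / real (Suc q) \<le> (1 / real (Suc p)) / 3" .
    moreover have "0 < 1 / real (Suc p)" by simp
    moreover have "0 < a - b - b" if "b \<le> a / 3" "0 < a" for a b :: real
      using that by simp
    ultimately have "c > 0" unfolding c_def by blast
    have "norm (x n * of_real (kolmogorov_diameter ?E n (unit_ball_of ?E q) (unit_ball_of ?E p)))
        \<le> exp (- \<alpha> n * c) * smn ?E q x" for n
    proof -
      let ?d = "kolmogorov_diameter ?E n (unit_ball_of ?E q) (unit_ball_of ?E p)"
      have "p \<le> q" by (simp add: q_def)
      have "0 \<le> ?d" by (intro kolmogorov_diameter_nonneg absorbs_unit_ball \<open>p \<le> q\<close>)
      then have "norm (x n * of_real ?d) = norm (x n) * ?d" by (simp add: norm_mult)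
      also have "\<dots> \<le> norm (x n) * exp (- \<alpha> n * (1 / real (Suc p) - 1 / real (Suc q)))"
        by (intro mult_left_mono diameter_power_series_1_le \<alpha> \<open>p \<le> q\<close>) simp
      also have "\<dots> = exp (- \<alpha> n * c) * (norm (x n) * exp (- \<alpha> n / real (Suc q)))"
        by (simp add: c_def algebra_simps del: of_nat_Suc flip: exp_add)
      also have "\<dots> \<le> exp (- \<alpha> n * c) * smn ?E q x"
        using smn_power_series_1_le_iff[OF x, of q "smn ?E q x"] by (intro mult_left_mono) auto
      finally show ?thesis .
    qed
    then have "(\<lambda>n. x n * of_real (kolmogorov_diameter ?E n (unit_ball_of ?E q) (unit_ball_of ?E p))) \<longlonglongrightarrow> 0"
      by (intro Lim_null_comparison[OF _ tendsto_mult_left_zero[OF tendsto_exp_neg_exponent[OF \<alpha> \<open>c > 0\<close>]]])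
        (auto intro: always_eventually)
    moreover have "q > p" by (simp add: q_def)
    ultimately show "\<exists>q>p. (\<lambda>n. x n * of_real (kolmogorov_diameter ?E n (unit_ball_of ?E q) (unit_ball_of ?E p))) \<longlonglongrightarrow> 0"
      by blast
  qed
qed

text \<open>
  The diameters of every bounded set are dominated by a single weight, and those of the cube
  dominate one. Since \<open>\<alpha>\<^sub>n \<rightarrow> \<infinity>\<close>, raising the index of the
  weight turns boundedness of a quotient into convergence to zero.
\<close>

lemma approx_diametral_dim_power_series_1:
  assumes \<alpha>: "exponent_sequence \<alpha>"
  shows "approx_diametral_dim (\<Lambda>\<^sub>1 \<alpha> :: ('k::real_normed_field, nat \<Rightarrow> 'k) seminormed_space)
    = {t. \<exists>k c. \<forall>\<^sub>F n in sequentially. norm (t n) \<le> c * exp (- \<alpha> n / real (Suc k))}"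
    (is "_ = ?D")
proof
  let ?E = "\<Lambda>\<^sub>1 \<alpha> :: ('k, nat \<Rightarrow> 'k) seminormed_space"
  have pos: "0 \<le> \<alpha> n" for n using \<alpha> by (auto simp: exponent_sequence_def)
  interpret graded_space ?E
    by (rule graded_space_power_series_1[OF pos])
  show "approx_diametral_dim ?E \<subseteq> ?D"
  proof
    fix t assume t_mem: "t \<in> approx_diametral_dim ?E"
    obtain B p c where B: "bounded_set ?E B" "c > 0"
      and t: "\<forall>\<^sub>F n in sequentially. norm (t n) \<le> c * kolmogorov_diameter ?E n B (unit_ball_of ?E p)"
      by (rule approx_diametral_dimD[OF t_mem]) blast
    \<comment> \<open>The exponent \<open>1 / (p + 1) - 1 / (q + 1)\<close> of the diameters is at least
        \<open>1 / (k + 1) = 1 / (2 (p + 1))\<close>.\<close>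
    define q where "q = 3 * p + 3"
    define k where "k = 2 * p + 1"
    have "p \<le> q" by (simp add: q_def)
    obtain C where C: "C > 0" "\<And>n. kolmogorov_diameter ?E n B (unit_ball_of ?E p)
         \<le> C * kolmogorov_diameter ?E n (unit_ball_of ?E q) (unit_ball_of ?E p)"
      using diameter_bounded_set_le[OF B(1) \<open>p \<le> q\<close>] by blast
    have "c * kolmogorov_diameter ?E n B (unit_ball_of ?E p) \<le> c * C * exp (- \<alpha> n / real (Suc k))" for n
    proof -
      have "kolmogorov_diameter ?E n B (unit_ball_of ?E p)
          \<le> C * kolmogorov_diameter ?E n (unit_ball_of ?E q) (unit_ball_of ?E p)" by (rule C(2))
      also have "\<dots> \<le> C * exp (- \<alpha> n * (1 / real (Suc p) - 1 / real (Suc q)))"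
        by (intro mult_left_mono diameter_power_series_1_le \<alpha> \<open>p \<le> q\<close>) (use C in simp)
      also have "\<dots> \<le> C * exp (- \<alpha> n / real (Suc k))"
      proof -
        have "1 / real (Suc k) \<le> 1 / real (Suc p) - 1 / real (Suc q)"
        proof -
          have "1 / real (Suc q) \<le> 1 / (3 * real (Suc p))"
            by (intro divide_left_mono) (auto simp: q_def)
          also have "\<dots> \<le> (1 / real (Suc p)) / 2" by (simp add: field_simps)
          finally have "(1 / real (Suc p)) / 2 \<le> 1 / real (Suc p) - 1 / real (Suc q)"
            by linarith
          moreover have "1 / real (Suc k) = (1 / real (Suc p)) / 2" by (simp add: k_def)
          ultimately show ?thesis by simp
        qed
        from mult_left_mono[OF this pos[of n]] show ?thesis
          using C by simp
      qed
      finally show ?thesis using B(2) by (simp add: mult.assoc)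
    qed
    then have "\<forall>\<^sub>F n in sequentially. norm (t n) \<le> (c * C) * exp (- \<alpha> n / real (Suc k))"
      using t by (auto elim!: eventually_mono intro: order_trans)
    then show "t \<in> ?D" by blast
  qed
  show "?D \<subseteq> approx_diametral_dim ?E"
  proof
    fix t assume "t \<in> ?D"
    then obtain k c where t: "\<forall>\<^sub>F n in sequentially. norm (t n) \<le> c * exp (- \<alpha> n / real (Suc k))"
      by blast
    let ?Q = "{x :: nat \<Rightarrow> 'k. \<forall>n. norm (x n) \<le> 1}"
    define r where "r = 1 / real (Suc k) - 1 / real (Suc (Suc k))"
    have "r > 0" unfolding r_def by (simp add: frac_less2 del: of_nat_Suc)
    have "\<forall>\<^sub>F n in sequentially. norm (t n)
        \<le> (\<bar>c\<bar> * exp (- \<alpha> n * r)) * kolmogorov_diameter ?E n ?Q (unit_ball_of ?E (Suc k))"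
      using t
    proof eventually_elim
      case (elim n)
      also have "c * exp (- \<alpha> n / real (Suc k)) \<le> \<bar>c\<bar> * exp (- \<alpha> n / real (Suc k))"
        by (intro mult_right_mono) auto
      also have "\<dots> = (\<bar>c\<bar> * exp (- \<alpha> n * r)) * exp (- \<alpha> n / real (Suc (Suc k)))"
        by (simp add: r_def algebra_simps del: of_nat_Suc flip: exp_add)
      also have "\<dots> \<le> (\<bar>c\<bar> * exp (- \<alpha> n * r)) * kolmogorov_diameter ?E n ?Q (unit_ball_of ?E (Suc k))"
        by (intro mult_left_mono diameter_cube_ge \<alpha>) auto
      finally show ?case .
    qed
    moreover have "(\<lambda>n. \<bar>c\<bar> * exp (- \<alpha> n * r)) \<longlonglongrightarrow> 0"
      by (intro tendsto_mult_right_zero tendsto_exp_neg_exponent \<alpha> \<open>r > 0\<close>)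
    ultimately show "t \<in> approx_diametral_dim ?E"
      by (intro approx_diametral_dimI[OF bounded_set_cube[OF pos]])
  qed
qed

section \<open>Gliding humps\<close>

lemma subsequence_from_infinitely_often:
  assumes "\<And>p::nat. \<exists>\<^sub>F n in sequentially. P p n"
  obtains \<nu> :: "nat \<Rightarrow> nat" where "strict_mono \<nu>" "\<And>p. P p (\<nu> p)"
proof -
  have "\<exists>m. P p m \<and> N < m" for p N
    using assms[of p] by (auto simp: frequently_sequentially) (meson Suc_le_eq)
  then have "\<exists>\<nu>. \<forall>p. P p (\<nu> p) \<and> \<nu> p < \<nu> (Suc p)"
    by (intro dependent_nat_choice) auto
  then show thesis using that by (auto simp: strict_mono_Suc_iff)
qed

text \<open>
  If no weight eventually dominates \<open>d\<close>, then \<open>d\<close> exceeds the \<open>k\<close>-th weight at some index \<open>\<nu> k\<close>, where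
  \<open>\<nu>\<close> increases strictly. The sequence with the entries \<open>1 / d\<close> at these indices belongs to the power
  series space, yet its product with \<open>d\<close> is \<open>1\<close> infinitely often.
\<close>

lemma exponential_bound_if_null_on_power_series_1:
  fixes d :: "nat \<Rightarrow> real"
  assumes \<alpha>: "\<And>n. 0 \<le> \<alpha> n"
    and null: "\<And>x :: nat \<Rightarrow> 'k::real_normed_field.
      x \<in> carr (\<Lambda>\<^sub>1 \<alpha>) \<Longrightarrow> (\<lambda>n. x n * of_real (d n)) \<longlonglongrightarrow> 0"
  shows "\<exists>k. \<forall>\<^sub>F n in sequentially. d n \<le> exp (- \<alpha> n / real (Suc k))"
proof (rule ccontr)
  assume "\<not> ?thesis"
  then have "\<And>k. \<exists>\<^sub>F n in sequentially. exp (- \<alpha> n / real (Suc k)) < d n"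
    by (simp add: not_eventually not_le)
  then obtain \<nu> where \<nu>: "strict_mono \<nu>" "\<And>k. exp (- \<alpha> (\<nu> k) / real (Suc k)) < d (\<nu> k)"
    by (rule subsequence_from_infinitely_often[where P = "\<lambda>k n. exp (- \<alpha> n / real (Suc k)) < d n"]) blast
  define x :: "nat \<Rightarrow> 'k" where "x n = (if n \<in> range \<nu> then of_real (1 / d n) else 0)" for n
  have pos: "0 < d (\<nu> k)" for k using \<nu>(2)[of k] by (rule order_less_trans[rotated]) simp
  have "norm (x n) * exp (- \<alpha> n / real (Suc k)) \<le> 1" if "n \<ge> \<nu> k" for n k
  proof (cases "n \<in> range \<nu>")
    case True
    then obtain j where j: "n = \<nu> j" by blast
    with that \<nu>(1) have "k \<le> j" by (simp add: strict_mono_less_eq)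
    then have "\<alpha> n / real (Suc j) \<le> \<alpha> n / real (Suc k)"
      using \<alpha>[of n] by (intro divide_left_mono) auto
    then have "exp (- \<alpha> n / real (Suc k)) \<le> exp (- \<alpha> n / real (Suc j))" by simp
    also have "\<dots> \<le> d n" using \<nu>(2)[of j] j by simp
    finally show ?thesis
      using True pos[of j] j by (simp add: x_def norm_divide divide_le_eq del: of_nat_Suc)
  qed (simp add: x_def)
  then have "x \<in> carr (\<Lambda>\<^sub>1 \<alpha>)"
    unfolding mem_carr_power_series_1
    by (intro allI bdd_above_range_if_eventually_le) (auto simp: eventually_sequentially)
  from null[OF this] have "(\<lambda>k. x (\<nu> k) * of_real (d (\<nu> k))) \<longlonglongrightarrow> 0"
    using LIMSEQ_subseq_LIMSEQ[OF _ \<nu>(1)] by (auto simp: o_def)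
  moreover have "x (\<nu> k) * of_real (d (\<nu> k)) = 1" for k
    using pos[of k] by (simp add: x_def flip: of_real_mult)
  ultimately show False by (simp add: LIMSEQ_const_iff)
qed

text \<open>
  If \<open>w\<close> is not dominated by any \<open>D p\<close>, then \<open>w > (p + 1)\<^sup>2 D p\<close> at some index \<open>\<nu> p\<close>, where \<open>\<nu>\<close>
  increases strictly. The entries \<open>(p + 1) / w\<close> at these indices make \<open>x w\<close> unbounded, while the
  square leaves \<open>x D\<close> below \<open>1 / (p + 1)\<close>; monotonicity of \<open>D\<close> in \<open>p\<close> extends this to every
  fixed \<open>D p\<close>.
\<close>

lemma weight_dominated_if_bounded_on_null_space:
  fixes D :: "nat \<Rightarrow> nat \<Rightarrow> real" and w :: "nat \<Rightarrow> real"
  assumes D_nonneg: "\<And>p n. 0 \<le> D p n" and D_mono: "\<And>p q n. p \<le> q \<Longrightarrow> D p n \<le> D q n"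
    and w_pos: "\<And>n. 0 < w n"
    and bdd: "\<And>x :: nat \<Rightarrow> 'k::real_normed_field.
      (\<And>p. (\<lambda>n. x n * of_real (D p n)) \<longlonglongrightarrow> 0) \<Longrightarrow> bdd_above (range (\<lambda>n. norm (x n) * w n))"
  shows "\<exists>p c. \<forall>\<^sub>F n in sequentially. w n \<le> c * D p n"
proof (rule ccontr)
  assume "\<not> ?thesis"
  then have "\<And>p. \<exists>\<^sub>F n in sequentially. real (Suc p) ^ 2 * D p n < w n"
    by (auto simp: not_eventually not_le)
  then obtain \<nu> where \<nu>: "strict_mono \<nu>" "\<And>p. real (Suc p) ^ 2 * D p (\<nu> p) < w (\<nu> p)"
    by (rule subsequence_from_infinitely_often[where P = "\<lambda>p n. real (Suc p) ^ 2 * D p n < w n"]) blast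
  have inj: "inj \<nu>" using \<nu>(1) by (rule strict_mono_imp_inj_on)
  define x :: "nat \<Rightarrow> 'k"
    where "x n = (if n \<in> range \<nu> then of_real (real (Suc (inv \<nu> n)) / w n) else 0)" for n
  have x\<nu>: "x (\<nu> j) = of_real (real (Suc j) / w (\<nu> j))" for j
    by (simp add: x_def inv_f_f[OF inj])
  have "(\<lambda>n. x n * of_real (D p n)) \<longlonglongrightarrow> 0" for p
  proof (rule LIMSEQ_I)
    fix e :: real assume "e > 0"
    then obtain J where J: "inverse (real (Suc J)) < e" using reals_Archimedean by blast
    have "norm (x n * of_real (D p n)) < e" if n: "n \<ge> \<nu> (max p J)" for n
    proof (cases "n \<in> range \<nu>")
      case True
      then obtain j where j: "n = \<nu> j" by blast
      with n \<nu>(1) have jj: "p \<le> j" "J \<le> j" by (simp_all add: strict_mono_less_eq)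
      have "norm (x n * of_real (D p n)) = real (Suc j) * D p n / w n"
        using D_nonneg w_pos[of n] by (simp add: x\<nu> j norm_mult norm_divide del: of_nat_Suc)
      also have "\<dots> \<le> real (Suc j) * D j n / w n"
        using D_mono[OF jj(1)] w_pos[of n] by (intro divide_right_mono mult_left_mono) auto
      also have "\<dots> \<le> inverse (real (Suc j))"
        using \<nu>(2)[of j] w_pos[of n] j by (simp add: field_simps power2_eq_square del: of_nat_Suc)
      also have "\<dots> \<le> inverse (real (Suc J))" using jj(2) by simp
      finally show ?thesis using J by simp
    qed (use \<open>e > 0\<close> in \<open>simp add: x_def\<close>)
    then show "\<exists>N. \<forall>n\<ge>N. norm (x n * of_real (D p n) - 0) < e" by auto
  qed
  then have "bdd_above (range (\<lambda>n. norm (x n) * w n))" by (rule bdd)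
  then obtain M where M: "\<And>n. norm (x n) * w n \<le> M"
    unfolding bdd_above_def by auto
  have "real (Suc j) \<le> M" for j
    using M[of "\<nu> j"] w_pos[of "\<nu> j"] by (simp add: x\<nu> norm_divide del: of_nat_Suc)
  moreover obtain j where "M < real j" using reals_Archimedean2 by blast
  ultimately show False by (metis lessI not_less of_nat_less_iff order_less_trans)
qed

section \<open>The characterization\<close>

theorem theorem4p8:
  fixes E :: "('k::real_normed_field, 'e::ab_group_add) seminormed_space"
    and \<epsilon> :: "nat \<Rightarrow> real"
  assumes "frechet E"
    and "\<forall>k. hilbertian_seminorm E (smn E k)"
    and "nuclear E"
    and "DN_underline E"
    and "Omega_property E"
    and "associated_exponent_sequence E \<epsilon>"
    and "nuclear (\<Lambda>\<^sub>1 \<epsilon> :: ('k, nat \<Rightarrow> 'k) seminormed_space)"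
  shows "approx_diametral_dim E
           = approx_diametral_dim (\<Lambda>\<^sub>1 \<epsilon> :: ('k, nat \<Rightarrow> 'k) seminormed_space)
         \<longleftrightarrow> (\<exists>B. prominent E B) \<and> diametral_dim E = carr (\<Lambda>\<^sub>1 \<epsilon>)"
proof -
  let ?\<Lambda> = "\<Lambda>\<^sub>1 \<epsilon> :: ('k, nat \<Rightarrow> 'k) seminormed_space"
  interpret graded_space E by (rule graded_space_frechet[OF assms(1)])
  have \<epsilon>: "exponent_sequence \<epsilon>" "diametral_dim ?\<Lambda> \<subseteq> diametral_dim E"
    using assms(6) by (auto simp: associated_exponent_sequence_def)
  then have pos: "0 \<le> \<epsilon> n" for n by (auto simp: exponent_sequence_def)
  have sub: "carr ?\<Lambda> \<subseteq> diametral_dim E"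
    using power_series_1_subset_diametral_dim[OF \<epsilon>(1)] \<epsilon>(2) by blast
  note dual = approx_diametral_dim_power_series_1[OF \<epsilon>(1), where 'k = 'k]
  let ?d = "\<lambda>B p n. kolmogorov_diameter E n B (unit_ball_of E p)"
  have approx_sub: "approx_diametral_dim E \<subseteq> approx_diametral_dim ?\<Lambda>"
  proof
    fix t assume t_mem: "t \<in> approx_diametral_dim E"
    obtain B p c where B: "bounded_set E B" "c > 0"
      and t: "\<forall>\<^sub>F n in sequentially. norm (t n) \<le> c * ?d B p n"
      by (rule approx_diametral_dimD[OF t_mem]) blast
    have "(\<lambda>n. x n * of_real (?d B p n)) \<longlonglongrightarrow> 0" if "x \<in> carr ?\<Lambda>" for x
      using diametral_dim_bounded_set[OF _ B(1)] sub that by blast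
    then obtain k where k: "\<forall>\<^sub>F n in sequentially. ?d B p n \<le> exp (- \<epsilon> n / real (Suc k))"
      using exponential_bound_if_null_on_power_series_1
        [where 'k = 'k and \<alpha> = \<epsilon> and d = "?d B p", OF pos] by blast
    from t k have "\<forall>\<^sub>F n in sequentially. norm (t n) \<le> c * exp (- \<epsilon> n / real (Suc k))"
      by eventually_elim (use B(2) in \<open>auto intro: order_trans\<close>)
    then show "t \<in> approx_diametral_dim ?\<Lambda>" unfolding dual by blast
  qed
  show ?thesis
  proof
    assume eq: "approx_diametral_dim E = approx_diametral_dim ?\<Lambda>"
    define dominates where "dominates k B p c \<longleftrightarrow> bounded_set E B \<and> c > 0 \<and>
        (\<forall>\<^sub>F n in sequentially. exp (- \<epsilon> n / real (Suc k)) \<le> c * ?d B p n)" for k B p c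
    have "\<exists>B p c. dominates k B p c" for k
    proof -
      have "(\<lambda>n. of_real (exp (- \<epsilon> n / real (Suc k))) :: 'k) \<in> approx_diametral_dim E"
        unfolding eq dual by (intro CollectI exI[of _ k] exI[of _ "1::real"]) simp
      then obtain B p c where "bounded_set E B" "c > 0" and
        "\<forall>\<^sub>F n in sequentially. norm (of_real (exp (- \<epsilon> n / real (Suc k))) :: 'k) \<le> c * ?d B p n"
        by (rule approx_diametral_dimD)
      then have "dominates k B p c"
        by (simp add: dominates_def del: of_nat_Suc)
      then show ?thesis by blast
    qed
    then obtain B p c where "\<And>k. dominates k (B k) (p k) (c k)"
      by metis
    then have B: "\<And>k. bounded_set E (B k)" and c: "\<And>k. c k > 0"
      and exp_le: "\<And>k. \<forall>\<^sub>F n in sequentially. exp (- \<epsilon> n / real (Suc k)) \<le> c k * ?d (B k) (p k) n"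
      by (simp_all add: dominates_def)
    have carrI: "x \<in> carr ?\<Lambda>" if x: "\<And>k. (\<lambda>n. x n * of_real (?d (B k) (p k) n)) \<longlonglongrightarrow> 0" for x
      unfolding mem_carr_power_series_1
    proof (intro allI bdd_above_range_if_eventually_le[of _ "c _"])
      fix k
      have "\<forall>\<^sub>F n in sequentially. norm (x n * of_real (?d (B k) (p k) n)) < 1"
        using order_tendstoD(2)[OF tendsto_norm_zero[OF x[of k]], of 1] by simp
      with exp_le[of k]
      show "\<forall>\<^sub>F n in sequentially. norm (x n) * exp (- \<epsilon> n / real (Suc k)) \<le> c k"
      proof eventually_elim
        case (elim n)
        have "0 \<le> ?d (B k) (p k) n"
          by (intro kolmogorov_diameter_nonneg absorbs_bounded_set B)
        then have *: "norm (x n) * ?d (B k) (p k) n < 1" using elim(2) by (simp add: norm_mult)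
        have "norm (x n) * exp (- \<epsilon> n / real (Suc k)) \<le> norm (x n) * (c k * ?d (B k) (p k) n)"
          by (intro mult_left_mono elim(1)) simp
        also have "\<dots> = c k * (norm (x n) * ?d (B k) (p k) n)" by simp
        also have "\<dots> \<le> c k" using * c[of k] by (simp add: mult_left_le)
        finally show ?case .
      qed
    qed
    have "diametral_dim E = carr ?\<Lambda>"
    proof (intro antisym sub subsetI)
      fix x assume "x \<in> diametral_dim E"
      then show "x \<in> carr ?\<Lambda>"
        by (intro carrI) (rule diametral_dim_bounded_set[OF _ B])
    qed
    moreover have "\<exists>D. prominent E D"
    proof -
      obtain D where D: "absolutely_convex E D" "bounded_set E D" "\<And>k. absorbs D (B k)"
        by (rule bounded_set_absorbing_sequence[where B = B, OF B]) (rule that)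
      have "x \<in> diametral_dim E" if x: "\<And>p. (\<lambda>n. x n * of_real (?d D p n)) \<longlonglongrightarrow> 0" for x
      proof -
        have "(\<lambda>n. x n * of_real (?d (B k) (p k) n)) \<longlonglongrightarrow> 0" for k
        proof -
          obtain b where b: "b > 0" "\<forall>v\<in>B k. \<exists>u\<in>D. v = scl E (of_real b) u"
            using D(3)[of k] by (auto simp: absorbs_def)
          have le: "?d (B k) (p k) n \<le> b / 1 * ?d D (p k) n" for n
            by (intro kolmogorov_diameter_scale absorbs_bounded_set D) (use b in auto)
          have "norm (x n * of_real (?d (B k) (p k) n)) \<le> norm (x n * of_real (?d D (p k) n)) * b" for n
          proof -
            have "0 \<le> ?d (B k) (p k) n" "0 \<le> ?d D (p k) n"
              by (intro kolmogorov_diameter_nonneg absorbs_bounded_set B D)+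
            then show ?thesis
              using mult_left_mono[OF le[of n], of "norm (x n)"] by (simp add: norm_mult ac_simps)
          qed
          then show ?thesis
            by (intro Lim_null_comparison[OF _ tendsto_mult_left_zero[OF tendsto_norm_zero[OF x[of "p k"]], of b]])
              (auto intro: always_eventually)
        qed
        then have "x \<in> carr ?\<Lambda>" by (rule carrI)
        with sub show ?thesis by (rule subsetD)
      qed
      then have "prominent E D" using D(1,2) by (simp add: prominent_def)
      then show ?thesis by (rule exI)
    qed
    ultimately show "(\<exists>B. prominent E B) \<and> diametral_dim E = carr ?\<Lambda>" by blast
  next
    assume "(\<exists>B. prominent E B) \<and> diametral_dim E = carr ?\<Lambda>"
    then obtain B where B: "prominent E B" and eq: "diametral_dim E = carr ?\<Lambda>" by blast
    have bdd: "bounded_set E B" using B by (simp add: prominent_def)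
    have "approx_diametral_dim ?\<Lambda> \<subseteq> approx_diametral_dim E"
    proof
      fix t assume "t \<in> approx_diametral_dim ?\<Lambda>"
      then obtain k c where t: "\<forall>\<^sub>F n in sequentially. norm (t n) \<le> c * exp (- \<epsilon> n / real (Suc k))"
        unfolding dual by blast
      \<comment> \<open>The next weight is used, so that its ratio to the \<open>k\<close>-th one still tends to zero.\<close>
      have "\<exists>p C. \<forall>\<^sub>F n in sequentially. exp (- \<epsilon> n / real (Suc (Suc k))) \<le> C * ?d B p n"
      proof (rule weight_dominated_if_bounded_on_null_space[where 'k = 'k])
        fix x :: "nat \<Rightarrow> 'k" assume "\<And>p. (\<lambda>n. x n * of_real (?d B p n)) \<longlonglongrightarrow> 0"
        then have "x \<in> diametral_dim E" using B by (simp add: prominent_def)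
        then have "x \<in> carr ?\<Lambda>" by (simp only: eq)
        then show "bdd_above (range (\<lambda>n. norm (x n) * exp (- \<epsilon> n / real (Suc (Suc k)))))"
          by (simp only: mem_carr_power_series_1)
      qed (auto intro: diameter_mono_ball[OF bdd] kolmogorov_diameter_nonneg absorbs_bounded_set[OF bdd])
      then obtain p C where C: "\<forall>\<^sub>F n in sequentially. exp (- \<epsilon> n / real (Suc (Suc k))) \<le> C * ?d B p n"
        by blast
      define r where "r = 1 / real (Suc k) - 1 / real (Suc (Suc k))"
      have "r > 0" unfolding r_def by (simp add: frac_less2 del: of_nat_Suc)
      from t C have "\<forall>\<^sub>F n in sequentially. norm (t n) \<le> (\<bar>c\<bar> * C * exp (- \<epsilon> n * r)) * ?d B p n"
      proof eventually_elim
        case (elim n)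
        have "norm (t n) \<le> \<bar>c\<bar> * exp (- \<epsilon> n / real (Suc k))"
          by (rule order_trans[OF elim(1)]) (intro mult_right_mono, auto)
        also have "\<dots> = (\<bar>c\<bar> * exp (- \<epsilon> n * r)) * exp (- \<epsilon> n / real (Suc (Suc k)))"
          by (simp add: r_def algebra_simps del: of_nat_Suc flip: exp_add)
        also have "\<dots> \<le> (\<bar>c\<bar> * exp (- \<epsilon> n * r)) * (C * ?d B p n)"
          by (intro mult_left_mono elim(2)) simp
        finally show ?case by (simp add: ac_simps)
      qed
      moreover have "(\<lambda>n. \<bar>c\<bar> * C * exp (- \<epsilon> n * r)) \<longlonglongrightarrow> 0"
        by (intro tendsto_mult_right_zero tendsto_exp_neg_exponent \<epsilon> \<open>r > 0\<close>)
      ultimately show "t \<in> approx_diametral_dim E"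
        by (intro approx_diametral_dimI[OF bdd])
    qed
    with approx_sub show "approx_diametral_dim E = approx_diametral_dim ?\<Lambda>" by blast
  qed
qed

end
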